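(* Let $(Y,Z)$ be a cross-intersecting EKR set of generators of a finite classical polar space $\mathcal{P}$ of rank $d$, and let $n$ be the number of generators of $\mathcal{P}$. Then: (i) If $\mathcal{P}=Q^+(2d-1,q)$, then $\sqrt{|Y|\cdot|Z|}\le n/2$, and if equality holds, then $\chi_Y,\chi_Z\in W_0\perp W_d$. (ii) If $\mathcal{P}\in\{Q(2d,q),W(2d-1,q)\}$, then $\sqrt{|Y|\cdot|Z|}$ is at most the number of generators of $\mathcal{P}$ containing a fixed point, and if equality holds, then $\chi_Y,\chi_Z\in W_0\perp W_1\perp W_d$. (iii) If $\mathcal{P}\in\{H(2d,q),Q^-(2d+1,q)\}$ (with $q$ a square in the case of $H(2d,q)$), then $\sqrt{|Y|\cdot|Z|}$ is at most the number of generators of $\mathcal{P}$ containing a fixed point, and if equality holds, then $\chi_Y,\chi_Z\in W_0\perp W_1$.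
   Context: All dimensions are vector space dimensions. $Q^+(2d-1,q)$, $Q(2d,q)$, $Q^-(2d+1,q)$, $W(2d-1,q)$, $H(2d-1,q)$, $H(2d,q)$ ($q$ a prime power, a square in the Hermitian cases) denote the finite classical polar spaces of rank $d$ (hyperbolic, parabolic, elliptic quadric; symplectic; Hermitian) in projective spaces of the indicated projective dimension over $\mathbb{F}_q$; their elements are the totally isotropic, respectively totally singular, subspaces. Points are those of dimension 1, generators those of the maximal dimension $d$. A cross-intersecting EKR set of generators is a pair $(Y,Z)$ of sets of generators such that every $y\in Y$ and $z\in Z$ satisfy $\dim(y\cap z)\ge1$. The type $e$ of the polar space is $e=0$ for $Q^+(2d-1,q)$, $e=1/2$ for $H(2d-1,q)$, $e=1$ for $Q(2d,q)$ and $W(2d-1,q)$, $e=3/2$ for $H(2d,q)$, $e=2$ for $Q^-(2d+1,q)$. For $0\le i\le d$ let $A_i$ be the $0$-$1$ matrix indexed by generators with $(A_i)_{ab}=1$ iff $d-\dim(a\cap b)=i$. These are the adjacency matrices of a (cometric) association scheme, with common, pairwise orthogonal eigenspaces $W_0,\dots,W_d$ in their natural ordering: with $[m]=\frac{q^m-1}{q-1}$, $W_r$ is the eigenspace of $A_1$ for the eigenvalue $q^{e}[d-r]-[r]$; $W_0$ is spanned by the all-ones vector, and $A_d$ has eigenvalue $(-1)^r q^{\binom{d-r}{2}+\binom r2+e(d-r)}$ on $W_r$. $\chi_S$ is the characteristic ($0$-$1$) vector of a set $S$ of generators; $\perp$ denotes the orthogonal direct sum of subspaces. *)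

theory Defs
  imports "HOL-Analysis.Analysis"
begin

text \<open>
  The ambient space is \<open>'k ^ 'n\<close> over a finite field \<open>'k\<close> with \<open>q = CARD('k)\<close>; all
  dimensions are vector space dimensions (\<open>vec.dim\<close>).
\<close>

definition bilinear_form :: "('k::field ^ 'n \<Rightarrow> 'k ^ 'n \<Rightarrow> 'k) \<Rightarrow> bool" where
  "bilinear_form f \<longleftrightarrow>
     (\<forall>y. Vector_Spaces.linear (*s) (*) (\<lambda>x. f x y)) \<and>
     (\<forall>x. Vector_Spaces.linear (*s) (*) (\<lambda>y. f x y))"

definition nondegenerate_form :: "('k::field ^ 'n \<Rightarrow> 'k ^ 'n \<Rightarrow> 'k) \<Rightarrow> bool" where
  "nondegenerate_form f \<longleftrightarrow> (\<forall>x. (\<forall>y. f x y = 0) \<longrightarrow> x = 0)"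

definition symplectic_form :: "('k::field ^ 'n \<Rightarrow> 'k ^ 'n \<Rightarrow> 'k) \<Rightarrow> bool" where
  "symplectic_form f \<longleftrightarrow> bilinear_form f \<and> (\<forall>x. f x x = 0)"

text \<open>
  The field involution is \<open>x \<mapsto> x ^ s\<close> with \<open>s\<^sup>2 = q\<close>; in particular \<open>q\<close> is a square.
\<close>

definition hermitian_form :: "('k::{field,finite} ^ 'n \<Rightarrow> 'k ^ 'n \<Rightarrow> 'k) \<Rightarrow> bool" where
  "hermitian_form f \<longleftrightarrow> (\<exists>s::nat. s ^ 2 = CARD('k) \<and>
     (\<forall>y. Vector_Spaces.linear (*s) (*) (\<lambda>x. f x y)) \<and>
     (\<forall>x y. f y x = f x y ^ s))"

definition polarization :: "('k::field ^ 'n \<Rightarrow> 'k) \<Rightarrow> 'k ^ 'n \<Rightarrow> 'k ^ 'n \<Rightarrow> 'k" where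
  "polarization Q x y = Q (x + y) - Q x - Q y"

definition quadratic_form :: "('k::field ^ 'n \<Rightarrow> 'k) \<Rightarrow> bool" where
  "quadratic_form Q \<longleftrightarrow>
     (\<forall>c x. Q (c *s x) = c ^ 2 * Q x) \<and> bilinear_form (polarization Q)"

text \<open>
  In characteristic 2 the polarization of a nondegenerate quadratic form may have a nonzero
  radical (it does in odd dimension); only singular radical vectors are excluded.
\<close>

definition nondegenerate_quadratic :: "('k::field ^ 'n \<Rightarrow> 'k) \<Rightarrow> bool" where
  "nondegenerate_quadratic Q \<longleftrightarrow>
     (\<forall>x. Q x = 0 \<and> (\<forall>y. polarization Q x y = 0) \<longrightarrow> x = 0)"

definition totally_singular :: "('k::field ^ 'n \<Rightarrow> 'k) \<Rightarrow> ('k ^ 'n) set set" where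
  "totally_singular Q = {S. vec.subspace S \<and> (\<forall>x\<in>S. Q x = 0)}"

definition totally_isotropic :: "('k::field ^ 'n \<Rightarrow> 'k ^ 'n \<Rightarrow> 'k) \<Rightarrow> ('k ^ 'n) set set" where
  "totally_isotropic f = {S. vec.subspace S \<and> (\<forall>x\<in>S. \<forall>y\<in>S. f x y = 0)}"

text \<open>
  In rank \<open>d\<close>: \<open>Q\<^sup>+(2d-1,q)\<close>, \<open>H(2d-1,q)\<close>, \<open>Q(2d,q)\<close>, \<open>W(2d-1,q)\<close>, \<open>H(2d,q)\<close>, \<open>Q\<^sup>-(2d+1,q)\<close>.
\<close>

datatype polar_family =
  Hyperbolic | Hermitian_Odd | Parabolic | Symplectic | Hermitian_Even | Elliptic

text \<open>The vector space dimension is the projective dimension plus one.\<close>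

fun ambient_dim :: "polar_family \<Rightarrow> nat \<Rightarrow> nat" where
  "ambient_dim Hyperbolic d = 2 * d"
| "ambient_dim Hermitian_Odd d = 2 * d"
| "ambient_dim Parabolic d = 2 * d + 1"
| "ambient_dim Symplectic d = 2 * d"
| "ambient_dim Hermitian_Even d = 2 * d + 1"
| "ambient_dim Elliptic d = 2 * d + 2"

fun polar_type :: "polar_family \<Rightarrow> real" where
  "polar_type Hyperbolic = 0"
| "polar_type Hermitian_Odd = 1 / 2"
| "polar_type Parabolic = 1"
| "polar_type Symplectic = 1"
| "polar_type Hermitian_Even = 3 / 2"
| "polar_type Elliptic = 2"

definition arises_from_form :: "polar_family \<Rightarrow> ('k::{field,finite} ^ 'n) set set \<Rightarrow> bool" where
  "arises_from_form K P \<longleftrightarrow>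
     (if K \<in> {Hyperbolic, Parabolic, Elliptic}
      then \<exists>Q. quadratic_form Q \<and> nondegenerate_quadratic Q \<and> P = totally_singular Q
      else if K = Symplectic
      then \<exists>f. symplectic_form f \<and> nondegenerate_form f \<and> P = totally_isotropic f
      else \<exists>f. hermitian_form f \<and> nondegenerate_form f \<and> P = totally_isotropic f)"

text \<open>
  A polar space is given by the set \<open>P\<close> of all its elements (including the zero subspace).
  Ambient dimension and rank \<open>d\<close> (the Witt index of the form) together separate the
  hyperbolic from the elliptic quadrics.
\<close>

definition classical_polar_space ::
    "polar_family \<Rightarrow> nat \<Rightarrow> ('k::{field,finite} ^ 'n) set set \<Rightarrow> bool" where
  "classical_polar_space K d P \<longleftrightarrow>
     arises_from_form K P \<and> CARD('n) = ambient_dim K d \<and> Max (vec.dim ` P) = d"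

definition points :: "('k::field ^ 'n) set set \<Rightarrow> ('k ^ 'n) set set" where
  "points P = {p \<in> P. vec.dim p = 1}"

definition generators :: "nat \<Rightarrow> ('k::field ^ 'n) set set \<Rightarrow> ('k ^ 'n) set set" where
  "generators d P = {g \<in> P. vec.dim g = d}"

definition cross_intersecting_EKR ::
    "nat \<Rightarrow> ('k::field ^ 'n) set set \<Rightarrow> ('k ^ 'n) set set \<Rightarrow> ('k ^ 'n) set set \<Rightarrow> bool" where
  "cross_intersecting_EKR d P Y Z \<longleftrightarrow>
     Y \<subseteq> generators d P \<and> Z \<subseteq> generators d P \<and>
     (\<forall>y\<in>Y. \<forall>z\<in>Z. vec.dim (y \<inter> z) \<ge> 1)"

text \<open>
  Matrices and vectors indexed by generators are real functions on subspaces; vectors are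
  required to vanish off the set of generators. The truncated subtraction is harmless, as
  \<open>dim (a \<inter> b) \<le> d\<close> for generators \<open>a\<close>, \<open>b\<close>.
\<close>

definition adj_matrix :: "nat \<Rightarrow> nat \<Rightarrow> ('k::field ^ 'n) set \<Rightarrow> ('k ^ 'n) set \<Rightarrow> real" where
  "adj_matrix d i a b = of_bool (d - vec.dim (a \<inter> b) = i)"

definition gauss_number :: "real \<Rightarrow> nat \<Rightarrow> real" where
  "gauss_number q m = (q ^ m - 1) / (q - 1)"

definition eigenvalue :: "real \<Rightarrow> real \<Rightarrow> nat \<Rightarrow> nat \<Rightarrow> real" where
  "eigenvalue q e d r = q powr e * gauss_number q (d - r) - gauss_number q r"

definition eigenspace ::
    "polar_family \<Rightarrow> nat \<Rightarrow> ('k::{field,finite} ^ 'n) set set \<Rightarrow> nat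
      \<Rightarrow> (('k ^ 'n) set \<Rightarrow> real) set" where
  "eigenspace K d P r =
     {v. (\<forall>a. a \<notin> generators d P \<longrightarrow> v a = 0) \<and>
         (\<forall>a\<in>generators d P.
            (\<Sum>b\<in>generators d P. adj_matrix d 1 a b * v b)
              = eigenvalue (real CARD('k)) (polar_type K) d r * v a)}"

text \<open>
  The sum of the eigenspaces with index in \<open>R\<close>. For \<open>R \<subseteq> {0..d}\<close> the eigenvalues are
  pairwise distinct and the matrix is symmetric, so the sum is direct and orthogonal.
\<close>

definition eigenspace_sum ::
    "polar_family \<Rightarrow> nat \<Rightarrow> ('k::{field,finite} ^ 'n) set set \<Rightarrow> nat set
      \<Rightarrow> (('k ^ 'n) set \<Rightarrow> real) set" where
  "eigenspace_sum K d P R =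
     {v. \<exists>w. (\<forall>r\<in>R. w r \<in> eigenspace K d P r) \<and> v = (\<lambda>a. \<Sum>r\<in>R. w r a)}"

end

theory Submission
  imports Defs
begin

text \<open>
  The bound is the weighted Hoffman bound for the graph of opposite generators: \<open>Y\<close> and \<open>Z\<close> are
  cross-intersecting exactly if \<open>A\<^sub>d\<close> has no nonzero entry in \<open>Y \<times> Z\<close>, so
  \<open>\<langle>\<chi>\<^sub>Y, A\<^sub>d \<chi>\<^sub>Z\<rangle> = 0\<close>. Expanding both vectors along common eigenspaces, the all-ones component
  contributes \<open>k |Y| |Z| / n\<close> with \<open>k\<close> the valency, and it must be cancelled by the other components,
  on which \<open>A\<^sub>d\<close> acts with absolute value at most \<open>\<mu>\<close>. A weighted arithmetic-geometric mean inequality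
  gives \<open>sqrt (|Y| |Z|) \<le> n \<mu> / (k + \<mu>)\<close>, and in case of equality only components with eigenvalue of
  absolute value \<open>\<mu>\<close> survive (\<open>cross_hoffman_bound\<close>).

  The eigenvalues come from geometry, without the association scheme. For a singular subspace \<open>S\<close> let
  \<open>\<chi>\<^sub>S\<close> be the indicator of the generators containing \<open>S\<close>, and let \<open>U\<^sub>r\<close> be the span of those with
  \<open>dim S < r\<close>. Counting the neighbours of a generator that contain \<open>S\<close> gives
  \<open>A\<^sub>1 \<chi>\<^sub>S = (q\<^sup>e [d - j] - [j]) \<chi>\<^sub>S + \<Sum> \<chi>\<^sub>T\<close>, with \<open>j = dim S\<close> and \<open>T\<close> ranging over the hyperplanes of
  \<open>S\<close> (\<open>adjacency_contains_vec\<close>). The vector \<open>A\<^sub>d \<chi>\<^sub>S\<close> is a constant multiple of the indicator of the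
  generators meeting \<open>S\<close> trivially (\<open>opposite_contains_vec\<close>), which is
  \<open>(-1) ^ j q ^ (j choose 2) \<chi>\<^sub>S\<close> modulo \<open>U\<^sub>j\<close> (\<open>meets_vec_coefficient\<close>). So both matrices are triangular along the
  chain \<open>U\<^sub>0 \<subseteq> U\<^sub>1 \<subseteq> \<dots>\<close>, with explicit diagonal entries. Being symmetric, they act as scalars on each
  orthogonal layer \<open>U\<^sub>r\<^sub>+\<^sub>1 \<inter> U\<^sub>r\<^sup>\<bottom>\<close> (\<open>triangular_selfadjoint_eigen\<close>). This layer therefore consists of
  eigenvectors of \<open>A\<^sub>1\<close> for the \<open>r\<close>-th eigenvalue, and \<open>A\<^sub>d\<close> has on it the eigenvalue
  \<open>(-1) ^ r q ^ f r\<close> with \<open>f r = ((d - r) choose 2) + (r choose 2) + e (d - r)\<close>.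

  The function \<open>f\<close> is convex, so \<open>\<mu>\<close> is attained only at ends of the range: at \<open>r = d\<close>, with \<open>\<mu> = k\<close>, for
  \<open>e = 0\<close>; at \<open>r = 1\<close> and \<open>r = d\<close> for \<open>e = 1\<close>; only at \<open>r = 1\<close> for \<open>e > 1\<close>. The resulting bound is
  \<open>n / 2\<close> for \<open>e = 0\<close>, and \<open>n / (q\<^sup>d\<^sup>-\<^sup>1\<^sup>+\<^sup>e + 1)\<close> otherwise, which is the number of generators on a point
  (\<open>card_generators_point\<close>).

  All counting rests on two facts, where neighbours are generators that meet in dimension \<open>d - 1\<close>. If a singular subspace \<open>S\<close> meets a generator \<open>a\<close> in a
  hyperplane of \<open>S\<close>, then exactly one neighbour of \<open>a\<close> contains \<open>S\<close> (\<open>unique_neighbour\<close>). Moreover a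
  singular \<open>(d - 1)\<close>-space lies on exactly \<open>q\<^sup>e + 1\<close> generators (\<open>card_generators_over\<close>); this is the only
  place where the kind of form enters, through the ambient dimension and the number of singular vectors
  on an affine line.
\<close>


section \<open>Self-adjoint operators that are triangular along a chain of subspaces\<close>

lemma inner_weighted_am_gm:
  fixes x y :: "'a::real_inner"
  assumes t: "t > 0"
  shows "2 * \<bar>x \<bullet> y\<bar> \<le> t * (x \<bullet> x) + (y \<bullet> y) / t"
proof -
  define h where "h = t * (x \<bullet> x) + (y \<bullet> y) / t"
  have th: "t * h = t * (t * (x \<bullet> x)) + y \<bullet> y"
    using t by (simp add: h_def distrib_left)
  have "0 \<le> (t *\<^sub>R x + y) \<bullet> (t *\<^sub>R x + y)" by simp
  also have "\<dots> = t * h + 2 * (t * (x \<bullet> y))"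
    unfolding th
    by (simp add: inner_add_left inner_add_right inner_commute[of y x] distrib_left)
  finally have plus: "0 \<le> t * (h + 2 * (x \<bullet> y))" by (simp add: distrib_left)
  have "0 \<le> (t *\<^sub>R x - y) \<bullet> (t *\<^sub>R x - y)" by simp
  also have "\<dots> = t * h - 2 * (t * (x \<bullet> y))"
    unfolding th
    by (simp add: inner_diff_left inner_diff_right inner_commute[of y x] right_diff_distrib)
  finally have "0 \<le> t * (h - 2 * (x \<bullet> y))" by (simp add: right_diff_distrib)
  with plus have "0 \<le> h + 2 * (x \<bullet> y)" "0 \<le> h - 2 * (x \<bullet> y)"
    using t by (simp_all add: zero_le_mult_iff)
  then show ?thesis unfolding h_def by linarith
qed

text \<open>
  The numerical core of the Hoffman bound. Here \<open>X\<close> and \<open>Y\<close> stand for the squared norms of the components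
  of two vectors outside the all-ones direction, \<open>W\<close> for their inner products and \<open>c\<close> for the eigenvalues.
  The inequality \<open>W\<close> is used with the single weight \<open>t = sqrt (b / a)\<close>, for which both halves have the same
  leading term; tightness then forces \<open>(\<mu> - |c r|) (t X r + Y r / t) = 0\<close> for every \<open>r\<close>.
\<close>

lemma weighted_am_gm_bound:
  fixes c X Y W :: "'i \<Rightarrow> real" and a b n k \<mu> :: real
  assumes fin: "finite I"
    and X: "\<And>r. r \<in> I \<Longrightarrow> X r \<ge> 0" and Y: "\<And>r. r \<in> I \<Longrightarrow> Y r \<ge> 0"
    and W: "\<And>r t. r \<in> I \<Longrightarrow> t > 0 \<Longrightarrow> 2 * \<bar>W r\<bar> \<le> t * X r + Y r / t"
    and sumv: "(\<Sum>r\<in>I. X r) = a - a\<^sup>2 / n" and sumw: "(\<Sum>r\<in>I. Y r) = b - b\<^sup>2 / n"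
    and sumvw: "(\<Sum>r\<in>I. c r * W r) = - (k * a * b / n)"
    and ab: "a > 0" "b > 0" and n: "n > 0" and k: "k \<ge> 0"
    and \<mu>: "\<mu> > 0" "\<And>r. r \<in> I \<Longrightarrow> \<bar>c r\<bar> \<le> \<mu>"
  shows "sqrt (a * b) \<le> n * \<mu> / (k + \<mu>)"
    and "sqrt (a * b) = n * \<mu> / (k + \<mu>) \<Longrightarrow> r \<in> I \<Longrightarrow> \<bar>c r\<bar> < \<mu> \<Longrightarrow> X r = 0 \<and> Y r = 0"
proof -
  define g where "g = sqrt (a * b)"
  define t where "t = g / a"
  have g: "g > 0" "g\<^sup>2 = a * b" using ab by (auto simp: g_def)
  have t: "t > 0" "t * a = g" "b / t = g"
    using g ab by (auto simp: t_def field_simps power2_eq_square)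
  \<comment> \<open>By the choice of \<open>t\<close>, both \<open>t a\<close> and \<open>b / t\<close> equal the geometric mean \<open>g\<close>.\<close>
  define h where "h r = t * X r + Y r / t" for r
  have h0: "h r \<ge> 0" if "r \<in> I" for r using t X Y that by (simp add: h_def)
  have amgm: "2 * \<bar>W r\<bar> \<le> h r" if "r \<in> I" for r
    using W[OF that t(1)] by (simp add: h_def)
  have ta: "t * a\<^sup>2 = g * a" using t(2) by (simp add: power2_eq_square flip: mult.assoc)
  have "b\<^sup>2 / t = (b / t) * b" by (simp add: power2_eq_square)
  then have tb: "b\<^sup>2 / t = g * b" using t(3) by simp
  have "(\<Sum>r\<in>I. h r) = t * (a - a\<^sup>2 / n) + (b - b\<^sup>2 / n) / t"
    unfolding h_def sum.distrib sum_distrib_left[symmetric] sum_divide_distrib[symmetric]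
    using sumv sumw by simp
  also have "\<dots> = t * a - (t * a\<^sup>2) / n + (b / t - (b\<^sup>2 / t) / n)"
    by (simp add: right_diff_distrib diff_divide_distrib mult.commute)
  also have "\<dots> = 2 * g - g * (a + b) / n"
    unfolding ta tb t(2,3) by (simp add: distrib_left add_divide_distrib)
  finally have sumh: "(\<Sum>r\<in>I. h r) = 2 * g - g * (a + b) / n" .
  have "0 \<le> (sqrt a - sqrt b)\<^sup>2" by simp
  then have "2 * g \<le> a + b"
    using ab by (simp add: power2_diff g_def real_sqrt_mult)
  then have "g * (2 * g) / n \<le> g * (a + b) / n"
    using g n by (intro divide_right_mono mult_left_mono) auto
  then have sumh_le: "(\<Sum>r\<in>I. h r) \<le> 2 * g - 2 * g\<^sup>2 / n"
    using sumh by (simp add: power2_eq_square mult.left_commute)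
  have "2 * (k * g\<^sup>2 / n) = (\<Sum>r\<in>I. - (2 * (c r * W r)))"
    using sumvw g by (simp add: sum_negf sum_distrib_left[symmetric] mult.assoc)
  also have "\<dots> \<le> (\<Sum>r\<in>I. \<bar>c r\<bar> * h r)"
  proof (rule sum_mono)
    fix r assume "r \<in> I"
    have "- (2 * (c r * W r)) \<le> \<bar>c r\<bar> * (2 * \<bar>W r\<bar>)"
      using abs_ge_minus_self[of "c r * W r"] by (simp add: abs_mult mult.commute mult.left_commute)
    also have "\<dots> \<le> \<bar>c r\<bar> * h r" using amgm[OF \<open>r \<in> I\<close>] by (simp add: mult_left_mono)
    finally show "- (2 * (c r * W r)) \<le> \<bar>c r\<bar> * h r" .
  qed
  finally have lower: "2 * (k * g\<^sup>2 / n) \<le> (\<Sum>r\<in>I. \<bar>c r\<bar> * h r)" .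
  \<comment> \<open>The slack: it is nonnegative termwise and bounded by a positive multiple of the gap in the claim.\<close>
  define \<delta> where "\<delta> = (\<Sum>r\<in>I. (\<mu> - \<bar>c r\<bar>) * h r)"
  have term0: "0 \<le> (\<mu> - \<bar>c r\<bar>) * h r" if "r \<in> I" for r
    using \<mu>(2)[OF that] h0[OF that] by simp
  then have \<delta>0: "\<delta> \<ge> 0" unfolding \<delta>_def by (rule sum_nonneg)
  have "\<delta> = \<mu> * (\<Sum>r\<in>I. h r) - (\<Sum>r\<in>I. \<bar>c r\<bar> * h r)"
    by (simp add: \<delta>_def left_diff_distrib sum_subtractf sum_distrib_left)
  also have "\<dots> \<le> \<mu> * (2 * g - 2 * g\<^sup>2 / n) - 2 * (k * g\<^sup>2 / n)"
    using sumh_le lower \<mu>(1) by (intro diff_mono mult_left_mono) auto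
  also have "\<dots> = (2 * g / n) * (n * \<mu> - g * (k + \<mu>))"
    using n by (simp add: field_simps power2_eq_square)
  finally have \<delta>: "\<delta> \<le> (2 * g / n) * (n * \<mu> - g * (k + \<mu>))" .
  have kmu: "k + \<mu> > 0" using k \<mu> by linarith
  have "0 \<le> (2 * g / n) * (n * \<mu> - g * (k + \<mu>))" using \<delta> \<delta>0 by (rule order_trans[rotated])
  moreover have "2 * g / n > 0" using g n by simp
  ultimately have "0 \<le> n * \<mu> - g * (k + \<mu>)" by (simp only: zero_le_mult_iff) auto
  then have le: "g \<le> n * \<mu> / (k + \<mu>)" using kmu by (simp add: field_simps)
  show "sqrt (a * b) \<le> n * \<mu> / (k + \<mu>)" using le by (simp add: g_def)
  assume tight: "sqrt (a * b) = n * \<mu> / (k + \<mu>)" and r: "r \<in> I" "\<bar>c r\<bar> < \<mu>"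
  have "g = n * \<mu> / (k + \<mu>)" using tight by (simp only: g_def)
  then have "n * \<mu> - g * (k + \<mu>) = 0" using kmu by simp
  then have "\<delta> = 0" using \<delta> \<delta>0 by simp
  then have "(\<mu> - \<bar>c r\<bar>) * h r = 0"
    using term0 r(1) fin unfolding \<delta>_def by (subst (asm) sum_nonneg_eq_0_iff) auto
  then have "h r = 0" using r by auto
  moreover have "t * X r \<ge> 0" "Y r / t \<ge> 0" using t(1) X[OF r(1)] Y[OF r(1)] by simp_all
  ultimately have "t * X r = 0" "Y r / t = 0" unfolding h_def by linarith+
  then show "X r = 0 \<and> Y r = 0" using t(1) by simp
qed

definition layer :: "(nat \<Rightarrow> 'a::euclidean_space set) \<Rightarrow> nat \<Rightarrow> 'a set" where
  "layer U r = {u \<in> U (Suc r). \<forall>w\<in>U r. u \<bullet> w = 0}"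

locale subspace_chain =
  fixes U :: "nat \<Rightarrow> 'a::euclidean_space set"
  assumes chain_subspace: "subspace (U r)"
    and chain_mono: "r \<le> s \<Longrightarrow> U r \<subseteq> U s"
    and chain_0: "U 0 = {0}"
begin

lemma layer_orthogonal:
  assumes "u \<in> layer U r" "v \<in> layer U s" "r \<noteq> s"
  shows "u \<bullet> v = 0"
proof (cases "r < s")
  case True
  then have "u \<in> U s" using assms(1) chain_mono[of "Suc r" s] by (auto simp: layer_def)
  then show ?thesis using assms(2) by (simp add: layer_def inner_commute)
next
  case False
  then have "v \<in> U r" using assms(2,3) chain_mono[of "Suc s" r] by (auto simp: layer_def)
  then show ?thesis using assms(1) by (simp add: layer_def)
qed

lemma layer_decomposition:
  "x \<in> U m \<Longrightarrow> \<exists>w. (\<forall>r<m. w r \<in> layer U r) \<and> x = (\<Sum>r<m. w r)"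
proof (induction m arbitrary: x)
  case 0
  then show ?case using chain_0 by auto
next
  case (Suc m)
  obtain y z where y: "y \<in> span (U m)" and z: "\<And>w. w \<in> span (U m) \<Longrightarrow> orthogonal z w"
    and x: "x = y + z"
    using orthogonal_subspace_decomp_exists[of "U m" x] by metis
  have yU: "y \<in> U m" using y chain_subspace by (metis span_eq_iff)
  then obtain w where w: "\<forall>r<m. w r \<in> layer U r" "y = (\<Sum>r<m. w r)"
    using Suc.IH by blast
  have "z = x - y" using x by simp
  moreover have "y \<in> U (Suc m)" using yU chain_mono[of m "Suc m"] by auto
  ultimately have "z \<in> U (Suc m)" using Suc.prems chain_subspace subspace_diff by blast
  then have "z \<in> layer U m"
    using z by (auto simp: layer_def orthogonal_def span_base)
  then have "(\<forall>r<Suc m. (w(m := z)) r \<in> layer U r) \<and> x = (\<Sum>r<Suc m. (w(m := z)) r)"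
    using w x by (auto simp: less_Suc_eq)
  then show ?case by blast
qed

text \<open>
  The operator maps \<open>U r\<close> into itself, hence, being self-adjoint, also its orthogonal complement. So
  for \<open>u\<close> in the layer the vector \<open>A u - c r u\<close> lies in \<open>U r\<close> and is orthogonal to it.
\<close>

lemma triangular_selfadjoint_eigen:
  assumes A: "linear A" "\<And>u v. A u \<bullet> v = u \<bullet> A v"
    and tri: "\<And>r u. r \<le> d \<Longrightarrow> u \<in> U (Suc r) \<Longrightarrow> A u - c r *\<^sub>R u \<in> U r"
    and u: "u \<in> layer U r" and r: "r \<le> d"
  shows "A u = c r *\<^sub>R u"
proof -
  have stable: "A w \<in> U r" if w: "w \<in> U r" for w
  proof (cases r)
    case 0
    then show ?thesis using w chain_0 linear_0[OF A(1)] by auto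
  next
    case (Suc s)
    then have "A w - c s *\<^sub>R w \<in> U r"
      using tri[of s w] w r chain_mono[of s r] by auto
    moreover have "c s *\<^sub>R w \<in> U r" using w chain_subspace subspace_scale by blast
    ultimately show ?thesis using chain_subspace[of r] subspace_add by fastforce
  qed
  let ?v = "A u - c r *\<^sub>R u"
  have v: "?v \<in> U r" using tri r u by (auto simp: layer_def)
  have orth: "u \<bullet> w = 0" if "w \<in> U r" for w using u that by (auto simp: layer_def)
  have "?v \<bullet> ?v = u \<bullet> A ?v - c r * (u \<bullet> ?v)"
    using A(2)[of u ?v] by (simp add: inner_diff_left)
  also have "\<dots> = 0" using orth[OF v] orth[OF stable[OF v]] by simp
  finally show ?thesis by simp
qed

text \<open>
  In the application \<open>j\<close> is the all-ones vector, and \<open>y\<close>, \<open>z\<close> are indicator vectors of sets of sizes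
  \<open>a\<close>, \<open>b\<close>, which explains the conditions on inner products.
\<close>

theorem cross_hoffman_bound:
  assumes A: "linear A" "\<And>u v. A u \<bullet> v = u \<bullet> A v"
    and tri: "\<And>r u. r \<le> d \<Longrightarrow> u \<in> U (Suc r) \<Longrightarrow> A u - c r *\<^sub>R u \<in> U r"
    and U1: "U 1 = span {j}" and n: "j \<bullet> j = n" "n > 0"
    and y: "y \<in> U (Suc d)" "y \<bullet> y = a" "y \<bullet> j = a"
    and z: "z \<in> U (Suc d)" "z \<bullet> z = b" "z \<bullet> j = b"
    and yz: "y \<bullet> A z = 0"
    and k: "c 0 = k" "k \<ge> 0"
    and \<mu>: "\<mu> > 0" "\<And>r. 1 \<le> r \<Longrightarrow> r \<le> d \<Longrightarrow> \<bar>c r\<bar> \<le> \<mu>"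
  shows "sqrt (a * b) \<le> n * \<mu> / (k + \<mu>)"
    and "sqrt (a * b) = n * \<mu> / (k + \<mu>) \<Longrightarrow>
      \<exists>v w. (\<forall>r\<le>d. v r \<in> layer U r \<and> w r \<in> layer U r) \<and> y = (\<Sum>r\<le>d. v r) \<and> z = (\<Sum>r\<le>d. w r)
        \<and> (\<forall>r. 1 \<le> r \<and> r \<le> d \<and> \<bar>c r\<bar> < \<mu> \<longrightarrow> v r = 0 \<and> w r = 0)"
proof -
  obtain v where v: "\<And>r. r \<le> d \<Longrightarrow> v r \<in> layer U r" "y = (\<Sum>r\<le>d. v r)"
    using layer_decomposition[OF y(1)] by (auto simp: less_Suc_eq_le lessThan_Suc_atMost)
  obtain w where w: "\<And>r. r \<le> d \<Longrightarrow> w r \<in> layer U r" "z = (\<Sum>r\<le>d. w r)"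
    using layer_decomposition[OF z(1)] by (auto simp: less_Suc_eq_le lessThan_Suc_atMost)
  have inner_sums: "(\<Sum>r\<le>d. f r) \<bullet> (\<Sum>r\<le>d. g r) = (\<Sum>r\<le>d. f r \<bullet> g r)"
    if "\<And>r. r \<le> d \<Longrightarrow> f r \<in> layer U r" "\<And>r. r \<le> d \<Longrightarrow> g r \<in> layer U r" for f g
  proof -
    have "(\<Sum>r\<le>d. f r) \<bullet> (\<Sum>r\<le>d. g r) = (\<Sum>r\<le>d. \<Sum>s\<le>d. f r \<bullet> g s)"
      unfolding inner_sum_left inner_sum_right by (rule sum.swap)
    also have "\<dots> = (\<Sum>r\<le>d. \<Sum>s\<le>d. if s = r then f r \<bullet> g s else 0)"
      by (intro sum.cong refl) (auto intro!: layer_orthogonal[OF that(1) that(2)])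
    also have "\<dots> = (\<Sum>r\<le>d. f r \<bullet> g r)" by simp
    finally show ?thesis .
  qed
  have layer_scale: "t *\<^sub>R u \<in> layer U r" if "u \<in> layer U r" for t u r
    using that chain_subspace[of "Suc r"] by (auto simp: layer_def subspace_scale)
  have Aw: "A z = (\<Sum>r\<le>d. c r *\<^sub>R w r)"
    unfolding w(2) linear_sum[OF A(1)]
    by (intro sum.cong refl triangular_selfadjoint_eigen[OF A tri]) (use w(1) in auto)
  have j0: "j \<in> layer U 0" using U1 chain_0 by (auto simp: layer_def span_base)
  \<comment> \<open>The components in the bottom layer are the projections onto \<open>j\<close>.\<close>
  have bottom: "f 0 = (x / n) *\<^sub>R j"
    if f: "\<And>r. r \<le> d \<Longrightarrow> f r \<in> layer U r" and x: "(\<Sum>r\<le>d. f r) \<bullet> j = x" for f x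
  proof -
    have "f 0 \<in> span {j}" using f[of 0] U1 by (auto simp: layer_def)
    then obtain t where t: "f 0 = t *\<^sub>R j" by (auto simp: span_singleton)
    have "x = (\<Sum>r\<le>d. f r \<bullet> j)" using x by (simp add: inner_sum_left)
    also have "\<dots> = (\<Sum>r\<le>d. if r = 0 then f r \<bullet> j else 0)"
      by (intro sum.cong refl) (auto intro!: layer_orthogonal[OF f j0])
    also have "\<dots> = t * n" using t n by simp
    finally show ?thesis using t n by simp
  qed
  have v0: "v 0 = (a / n) *\<^sub>R j" using bottom[of v] v y(3) by blast
  have w0: "w 0 = (b / n) *\<^sub>R j" using bottom[of w] w z(3) by blast
  have split0: "(\<Sum>r\<le>d. g r) = g 0 + (\<Sum>r\<in>{1..d}. g r)" for g :: "nat \<Rightarrow> real"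
    by (simp add: atMost_atLeast0 sum.atLeast_Suc_atMost)
  have sumv: "(\<Sum>r\<in>{1..d}. v r \<bullet> v r) = a - a\<^sup>2 / n"
    using y(2) inner_sums[of v v] v split0[of "\<lambda>r. v r \<bullet> v r"] v0 n
    by (simp add: power2_eq_square)
  have sumw: "(\<Sum>r\<in>{1..d}. w r \<bullet> w r) = b - b\<^sup>2 / n"
    using z(2) inner_sums[of w w] w split0[of "\<lambda>r. w r \<bullet> w r"] w0 n
    by (simp add: power2_eq_square)
  have sumvw: "(\<Sum>r\<in>{1..d}. c r * (v r \<bullet> w r)) = - (k * a * b / n)"
  proof -
    have "0 = (\<Sum>r\<le>d. v r \<bullet> (c r *\<^sub>R w r))"
      using yz inner_sums[of v "\<lambda>r. c r *\<^sub>R w r"] v w layer_scale Aw by simp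
    then have "(\<Sum>r\<le>d. c r * (v r \<bullet> w r)) = 0" by simp
    moreover have "c 0 * (v 0 \<bullet> w 0) = k * a * b / n" using v0 w0 n k by simp
    ultimately show ?thesis using split0[of "\<lambda>r. c r * (v r \<bullet> w r)"] by linarith
  qed
  have a0: "a \<ge> 0" using y(2) inner_ge_zero by metis
  have b0: "b \<ge> 0" using z(2) inner_ge_zero by metis
  have main: "sqrt (a * b) \<le> n * \<mu> / (k + \<mu>) \<and> (sqrt (a * b) = n * \<mu> / (k + \<mu>) \<longrightarrow>
        (\<forall>r. 1 \<le> r \<and> r \<le> d \<and> \<bar>c r\<bar> < \<mu> \<longrightarrow> v r = 0 \<and> w r = 0))"
  proof (cases "a = 0 \<or> b = 0")
    case True
    have "n * \<mu> / (k + \<mu>) > 0" using n \<mu> k by (simp add: add_nonneg_pos)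
    then show ?thesis using True by auto
  next
    case False
    then have "a > 0" "b > 0" using a0 b0 by auto
    note bound = weighted_am_gm_bound[OF _ _ _ _ sumv sumw sumvw this n(2) k(2) \<mu>(1)]
    have "sqrt (a * b) \<le> n * \<mu> / (k + \<mu>)"
      by (rule bound(1)) (auto intro: inner_weighted_am_gm \<mu>(2))
    moreover have "v r \<bullet> v r = 0 \<and> w r \<bullet> w r = 0"
      if "sqrt (a * b) = n * \<mu> / (k + \<mu>)" "1 \<le> r" "r \<le> d" "\<bar>c r\<bar> < \<mu>" for r
      by (rule bound(2)[OF _ _ _ _ _ that(1)]) (use that in \<open>auto intro: inner_weighted_am_gm \<mu>(2)\<close>)
    ultimately show ?thesis by simp
  qed
  then show "sqrt (a * b) \<le> n * \<mu> / (k + \<mu>)" by blast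
  assume "sqrt (a * b) = n * \<mu> / (k + \<mu>)"
  with main have "\<forall>r. 1 \<le> r \<and> r \<le> d \<and> \<bar>c r\<bar> < \<mu> \<longrightarrow> v r = 0 \<and> w r = 0" by blast
  then show "\<exists>v w. (\<forall>r\<le>d. v r \<in> layer U r \<and> w r \<in> layer U r)
        \<and> y = (\<Sum>r\<le>d. v r) \<and> z = (\<Sum>r\<le>d. w r)
        \<and> (\<forall>r. 1 \<le> r \<and> r \<le> d \<and> \<bar>c r\<bar> < \<mu> \<longrightarrow> v r = 0 \<and> w r = 0)"
    by (intro exI[of _ v] exI[of _ w]) (use v w in simp)
qed

end

section \<open>Counting in finite vector spaces\<close>

lemma CARD_field_ge2: "CARD('k::{field,finite}) \<ge> 2"
proof -
  have "card {0, 1::'k} \<le> CARD('k)" by (rule card_mono) auto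
  then show ?thesis by simp
qed

lemma card_span_insert:
  fixes b :: "'k::{field,finite} ^ 'n"
  assumes b: "b \<notin> vec.span B"
  shows "card (vec.span (insert b B)) = CARD('k) * card (vec.span B)"
proof -
  have "bij_betw (\<lambda>(c, x). c *s b + x) (UNIV \<times> vec.span B) (vec.span (insert b B))"
  proof (rule bij_betwI')
    fix p p' :: "'k \<times> ('k ^ 'n)"
    assume p: "p \<in> UNIV \<times> vec.span B" "p' \<in> UNIV \<times> vec.span B"
    obtain c x c' x' where pp: "p = (c, x)" "p' = (c', x')" by fastforce
    have "p = p'" if eq: "c *s b + x = c' *s b + x'"
    proof -
      have "(c - c') *s b = x' - x" using eq by (simp add: vec.scale_left_diff_distrib algebra_simps)
      moreover have "x' - x \<in> vec.span B" using p pp by (simp add: vec.span_diff)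
      ultimately have s: "(c - c') *s b \<in> vec.span B" by simp
      have "c = c'"
      proof (rule ccontr)
        assume "c \<noteq> c'"
        then have "inverse (c - c') * (c - c') = 1" by simp
        then have "b = inverse (c - c') *s ((c - c') *s b)"
          by (simp only: vec.scale_scale vec.scale_one)
        then show False using vec.span_scale[OF s, of "inverse (c - c')"] b by simp
      qed
      then show ?thesis using eq pp by simp
    qed
    then show "((case p of (c, x) \<Rightarrow> c *s b + x) = (case p' of (c, x) \<Rightarrow> c *s b + x)) = (p = p')"
      using pp by auto
  next
    fix p :: "'k \<times> ('k ^ 'n)"
    assume "p \<in> UNIV \<times> vec.span B"
    then show "(case p of (c, x) \<Rightarrow> c *s b + x) \<in> vec.span (insert b B)"
      by (auto simp: vec.span_breakdown_eq intro!: exI[of _ "fst p"])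
  next
    fix y assume "y \<in> vec.span (insert b B)"
    then obtain c where "y - c *s b \<in> vec.span B" by (auto simp: vec.span_breakdown_eq)
    then show "\<exists>p\<in>UNIV \<times> vec.span B. y = (case p of (c, x) \<Rightarrow> c *s b + x)"
      by (intro bexI[of _ "(c, y - c *s b)"]) auto
  qed
  then have "card (vec.span (insert b B)) = card ((UNIV :: 'k set) \<times> vec.span B)"
    using bij_betw_same_card by metis
  then show ?thesis by (simp add: card_cartesian_product)
qed

lemma card_subspace:
  fixes S :: "('k::{field,finite} ^ 'n) set"
  assumes "vec.subspace S"
  shows "card S = CARD('k) ^ vec.dim S"
proof -
  have indep: "vec.independent B \<Longrightarrow> card (vec.span B) = CARD('k) ^ card B"
    for B :: "('k ^ 'n) set"
  proof (induction B rule: infinite_finite_induct)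
    case (insert x B)
    then show ?case
      using card_span_insert[of x B] by (simp add: vec.independent_insert)
  qed auto
  obtain B where "B \<subseteq> S" "vec.independent B" "S \<subseteq> vec.span B" "card B = vec.dim S"
    using vec.basis_exists[of S] by blast
  then show ?thesis using indep[of B] assms vec.span_minimal[of B S] by auto
qed

lemma card_subspace_diff:
  fixes S T :: "('k::{field,finite} ^ 'n) set"
  assumes "vec.subspace S" "vec.subspace T" "T \<subseteq> S"
  shows "real (card (S - T)) = real CARD('k) ^ vec.dim S - real CARD('k) ^ vec.dim T"
  using assms card_mono[OF _ assms(3)]
  by (simp add: card_Diff_subset card_subspace of_nat_diff)

lemma dim_insert_subspace:
  fixes S :: "('k::field ^ 'n) set"
  assumes "vec.subspace S" "x \<notin> S"
  shows "vec.dim (vec.span (insert x S)) = Suc (vec.dim S)"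
  using assms by (metis Suc_eq_plus1 vec.dim_insert vec.dim_span vec.span_eq_iff)

lemma span_insert_subset:
  fixes S :: "('k::field ^ 'n) set"
  assumes "vec.subspace T" "S \<subseteq> T" "x \<in> T"
  shows "vec.span (insert x S) \<subseteq> T"
  using assms by (simp add: vec.span_minimal)

lemma subset_span_insert:
  fixes S :: "('k::field ^ 'n) set"
  shows "S \<subseteq> vec.span (insert x S)" "x \<in> vec.span (insert x S)"
  by (auto simp: vec.span_base)

lemma subspace_eqI_dim:
  fixes S :: "('k::field ^ 'n) set"
  assumes "vec.subspace S" "vec.subspace T" "S \<subseteq> T" "vec.dim T \<le> vec.dim S"
  shows "S = T"
  using assms vec.subspace_dim_equal by blast

lemma dim_span_Un:
  fixes S T :: "('k::field ^ 'n) set"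
  assumes "vec.subspace S" "vec.subspace T"
  shows "vec.dim (vec.span (S \<union> T)) + vec.dim (S \<inter> T) = vec.dim S + vec.dim T"
proof -
  have "vec.span (S \<union> T) = {x + y |x y. x \<in> S \<and> y \<in> T}"
    using assms by (auto simp: vec.span_Un vec.span_eq_iff[THEN iffD2])
  then show ?thesis using vec.dim_sums_Int[OF assms] by metis
qed

lemma dim_Int_ge:
  fixes S T V :: "('k::field ^ 'n) set"
  assumes "vec.subspace S" "vec.subspace T" "vec.subspace V" "S \<subseteq> V" "T \<subseteq> V"
  shows "vec.dim S + vec.dim T \<le> vec.dim V + vec.dim (S \<inter> T)"
proof -
  have "vec.span (S \<union> T) \<subseteq> V" using assms by (simp add: vec.span_minimal)
  then have "vec.dim (vec.span (S \<union> T)) \<le> vec.dim V" by (rule vec.dim_subset)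
  then show ?thesis using dim_span_Un[OF assms(1,2)] by linarith
qed

lemma subspace_0I: "vec.subspace S \<Longrightarrow> vec.dim S = 0 \<longleftrightarrow> S = {0}"
  for S :: "('k::field ^ 'n) set"
  using vec.subspace_0 by (auto simp: vec.dim_eq_0)

lemma gauss_number_Suc: "q \<noteq> 1 \<Longrightarrow> gauss_number q (Suc m) - gauss_number q m = q ^ m"
  by (simp add: gauss_number_def divide_simps) (simp add: algebra_simps)

definition hyperplanes_over :: "('k::field ^ 'n) set \<Rightarrow> ('k ^ 'n) set \<Rightarrow> ('k ^ 'n) set set" where
  "hyperplanes_over S V = {H. vec.subspace H \<and> S \<subseteq> H \<and> H \<subseteq> V \<and> vec.dim H + 1 = vec.dim V}"

text \<open>
  Pairs of a hyperplane \<open>H\<close> and a vector of \<open>V\<close> outside \<open>H\<close> are counted in two ways. The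
  hyperplanes over \<open>S\<close> that avoid a vector \<open>x\<close> are those over \<open>S\<close> that are not over
  the span of \<open>S\<close> and \<open>x\<close>, which gives a recursion in the codimension of \<open>S\<close>.
\<close>

lemma card_hyperplanes_over:
  fixes S V :: "('k::{field,finite} ^ 'n) set"
  assumes "vec.subspace S" "vec.subspace V" "S \<subseteq> V"
  shows "real (card (hyperplanes_over S V)) = gauss_number (real CARD('k)) (vec.dim V - vec.dim S)"
  using assms
proof (induction "vec.dim V - vec.dim S" arbitrary: S rule: less_induct)
  case less
  let ?q = "real CARD('k)"
  define m where "m = vec.dim V - vec.dim S"
  have q: "?q \<ge> 2" using CARD_field_ge2[where 'k = 'k] by linarith
  have dimle: "vec.dim S \<le> vec.dim V" using less by (intro vec.dim_subset)
  consider "m = 0" | "m = 1" | "m \<ge> 2" by linarith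
  then show ?case
  proof cases
    case 1
    have False if "H \<in> hyperplanes_over S V" for H
    proof -
      have "vec.dim S \<le> vec.dim H"
        using that by (intro vec.dim_subset) (simp add: hyperplanes_over_def)
      then show False using that 1 by (simp add: hyperplanes_over_def m_def)
    qed
    then have "hyperplanes_over S V = {}" by blast
    then show ?thesis using 1 by (simp add: m_def gauss_number_def)
  next
    case 2
    have "H = S" if "H \<in> hyperplanes_over S V" for H
      using that 2 less.prems(1)
      by (intro subspace_eqI_dim[symmetric]) (auto simp: hyperplanes_over_def m_def)
    moreover have "S \<in> hyperplanes_over S V"
      using 2 less.prems dimle by (auto simp: hyperplanes_over_def m_def)
    ultimately have "hyperplanes_over S V = {S}" by blast
    then show ?thesis using 2 q by (simp add: m_def gauss_number_def)
  next
    case 3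
    let ?\<H> = "hyperplanes_over S V" and ?D = "vec.dim V"
    have fin: "finite ?\<H>" by simp
    have swap: "(\<Sum>x\<in>V - S. card {H\<in>?\<H>. x \<notin> H}) = (\<Sum>H\<in>?\<H>. card (V - H))"
      by (rule sum_multicount_gen) (auto simp: hyperplanes_over_def intro!: arg_cong[where f = card])
    have avoid: "real (card {H\<in>?\<H>. x \<notin> H}) = real (card ?\<H>) - gauss_number ?q (m - 1)"
      if x: "x \<in> V - S" for x
    proof -
      let ?S = "vec.span (insert x S)"
      have sub: "{H\<in>?\<H>. x \<notin> H} = ?\<H> - hyperplanes_over ?S V"
        "hyperplanes_over ?S V \<subseteq> ?\<H>"
        using subset_span_insert(1)[where S = S] subset_span_insert(2)[where S = S]
          span_insert_subset[where S = S]
        unfolding hyperplanes_over_def by blast+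
      have "?S \<subseteq> V" using x less by (intro span_insert_subset) auto
      moreover have dimS: "vec.dim ?S = Suc (vec.dim S)"
        using x less by (intro dim_insert_subspace) auto
      ultimately have "real (card (hyperplanes_over ?S V)) = gauss_number ?q (m - 1)"
        using less.hyps[of ?S] less.prems 3 by (simp add: m_def)
      then show ?thesis using sub by (simp add: card_Diff_subset of_nat_diff card_mono)
    qed
    have compl: "real (card (V - H)) = ?q ^ ?D - ?q ^ (?D - 1)" if "H \<in> ?\<H>" for H
    proof -
      have "vec.dim H = ?D - 1" using that by (auto simp: hyperplanes_over_def)
      then show ?thesis using that less card_subspace_diff[of V H]
        by (auto simp: hyperplanes_over_def)
    qed
    have "real (card (V - S)) * (real (card ?\<H>) - gauss_number ?q (m - 1))
        = (\<Sum>x\<in>V - S. real (card {H\<in>?\<H>. x \<notin> H}))"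
      using avoid by simp
    also have "\<dots> = (\<Sum>H\<in>?\<H>. real (card (V - H)))"
      using arg_cong[OF swap, of real] by (simp only: of_nat_sum)
    also have "\<dots> = real (card ?\<H>) * (?q ^ ?D - ?q ^ (?D - 1))"
      using compl by simp
    finally have "real (card (V - S)) * (real (card ?\<H>) - gauss_number ?q (m - 1))
        = real (card ?\<H>) * (?q ^ ?D - ?q ^ (?D - 1))" .
    moreover have "real (card (V - S)) = ?q ^ ?D - ?q ^ vec.dim S"
      using less by (intro card_subspace_diff)
    moreover have "?D = vec.dim S + m" "?D - 1 = vec.dim S + (m - 1)"
      using 3 dimle unfolding m_def by linarith+
    then have "?q ^ ?D = ?q ^ vec.dim S * ?q ^ m" "?q ^ (?D - 1) = ?q ^ vec.dim S * ?q ^ (m - 1)"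
      by (simp_all only: power_add)
    ultimately have "?q ^ vec.dim S * ((?q ^ m - 1) * (real (card ?\<H>) - gauss_number ?q (m - 1)))
        = ?q ^ vec.dim S * (real (card ?\<H>) * (?q ^ m - ?q ^ (m - 1)))"
      by (simp add: algebra_simps)
    then have "(?q ^ m - 1) * (real (card ?\<H>) - gauss_number ?q (m - 1))
        = real (card ?\<H>) * (?q ^ m - ?q ^ (m - 1))"
      using q by simp
    then have "real (card ?\<H>) * (?q ^ (m - 1) - 1) = (?q ^ m - 1) * gauss_number ?q (m - 1)"
      by (simp add: algebra_simps)
    also have "\<dots> = gauss_number ?q m * (?q ^ (m - 1) - 1)"
      using q by (simp add: gauss_number_def)
    finally have "real (card ?\<H>) * (?q ^ (m - 1) - 1) = gauss_number ?q m * (?q ^ (m - 1) - 1)" .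
    moreover have "?q ^ (m - 1) > 1" using q 3 by (intro one_less_power) auto
    ultimately show ?thesis by (simp add: m_def)
  qed
qed

section \<open>Generators of polar spaces\<close>

declare vec.subspace_inter [simp, intro] vec.subspace_0 [simp]

definition perp_set :: "('v \<Rightarrow> 'v \<Rightarrow> bool) \<Rightarrow> 'v set \<Rightarrow> 'v set" where
  "perp_set orth S = {x. \<forall>s\<in>S. orth s x}"

locale polar_geometry =
  fixes P :: "('k::{field,finite} ^ 'n) set set"
    and orth :: "'k ^ 'n \<Rightarrow> 'k ^ 'n \<Rightarrow> bool"
    and d :: nat
    and q :: real
  assumes q_card: "q = real CARD('k)"
    and element_subspace: "S \<in> P \<Longrightarrow> vec.subspace S"
    and element_down: "S \<in> P \<Longrightarrow> vec.subspace T \<Longrightarrow> T \<subseteq> S \<Longrightarrow> T \<in> P"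
    and element_orth: "S \<in> P \<Longrightarrow> x \<in> S \<Longrightarrow> y \<in> S \<Longrightarrow> orth x y"
    and orth_sym: "orth x y \<Longrightarrow> orth y x"
    and orth_subspace: "vec.subspace {y. orth x y}"
    and orth_codim: "vec.subspace A \<Longrightarrow> vec.dim A \<le> vec.dim (A \<inter> {y. orth x y}) + 1"
    and element_join: "S \<in> P \<Longrightarrow> T \<in> P \<Longrightarrow> (\<And>x y. x \<in> S \<Longrightarrow> y \<in> T \<Longrightarrow> orth x y)
        \<Longrightarrow> vec.span (S \<union> T) \<in> P"
    and element_dim_le: "S \<in> P \<Longrightarrow> vec.dim S \<le> d"
    and generator_exists: "generators d P \<noteq> {}"
begin

abbreviation "perp \<equiv> perp_set orth"
abbreviation "G \<equiv> generators d P"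

lemma q_ge2: "q \<ge> 2"
  using CARD_field_ge2[where 'k = 'k] q_card by linarith

lemma card_subspace_diff_q:
  "vec.subspace S \<Longrightarrow> vec.subspace T \<Longrightarrow> T \<subseteq> S \<Longrightarrow> real (card (S - T)) = q ^ vec.dim S - q ^ vec.dim T"
  for S T :: "('k ^ 'n) set"
  unfolding q_card by (rule card_subspace_diff)

lemma generatorD: "a \<in> G \<Longrightarrow> a \<in> P" "a \<in> G \<Longrightarrow> vec.dim a = d"
  "a \<in> G \<Longrightarrow> vec.subspace a"
  using element_subspace by (auto simp: generators_def)

lemma zero_element: "{0} \<in> P"
  using generator_exists element_down[of _ "{0}"] generatorD vec.subspace_0 vec.subspace_single_0
  by (metis all_not_in_conv empty_subsetI insert_subset)

lemma generator_eqI: "a \<in> G \<Longrightarrow> b \<in> G \<Longrightarrow> a \<subseteq> b \<Longrightarrow> a = b"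
  using subspace_eqI_dim[of a b] generatorD by simp

lemma subspace_perp: "vec.subspace (perp S)"
proof -
  have "perp S = \<Inter> ((\<lambda>s. {y. orth s y}) ` S)" by (auto simp: perp_set_def)
  then show ?thesis
    using orth_subspace vec.subspace_Inter[of "(\<lambda>s. {y. orth s y}) ` S"] by auto
qed

lemma perp_antimono: "S \<subseteq> T \<Longrightarrow> perp T \<subseteq> perp S"
  by (auto simp: perp_set_def)

lemma element_subset_perp: "S \<in> P \<Longrightarrow> S \<subseteq> perp S"
  using element_orth by (auto simp: perp_set_def)

text \<open>
  Extending \<open>U\<close> to \<open>S\<close> by one vector at a time, each vector imposes one more linear condition on \<open>A\<close>;
  the vectors of \<open>U\<close> impose none.
\<close>

lemma dim_Int_perp_ge:
  assumes "vec.subspace A" "vec.subspace S" "vec.subspace U" "U \<subseteq> S" "A \<subseteq> perp U"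
  shows "vec.dim A + vec.dim U \<le> vec.dim (A \<inter> perp S) + vec.dim S"
  using assms
proof (induction "vec.dim S - vec.dim U" arbitrary: U A rule: less_induct)
  case less
  show ?case
  proof (cases "U = S")
    case True
    then have "A \<inter> perp S = A" using less.prems by auto
    then show ?thesis using True by simp
  next
    case False
    then obtain x where x: "x \<in> S" "x \<notin> U" using less.prems by auto
    let ?U = "vec.span (insert x U)" and ?A = "A \<inter> {y. orth x y}"
    have sub: "?U \<subseteq> S" using x less.prems by (intro span_insert_subset) auto
    have dimU: "vec.dim ?U = Suc (vec.dim U)" using x less.prems by (intro dim_insert_subspace)
    have dimUS: "vec.dim ?U \<le> vec.dim S" using sub by (rule vec.dim_subset)
    have sA: "vec.subspace ?A"
      using less.prems(1) orth_subspace[of x] by (rule vec.subspace_inter)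
    have "?A \<subseteq> perp ?U"
    proof
      fix y assume y: "y \<in> ?A"
      have "insert x U \<subseteq> {u. orth y u}"
        using y less.prems(5) orth_sym by (auto simp: perp_set_def)
      then have "?U \<subseteq> {u. orth y u}" using orth_subspace[of y] by (intro vec.span_minimal)
      then show "y \<in> perp ?U" using orth_sym by (auto simp: perp_set_def)
    qed
    then have IH: "vec.dim ?A + vec.dim ?U \<le> vec.dim (?A \<inter> perp S) + vec.dim S"
      using less.hyps[of ?U ?A] sA sub dimU dimUS less.prems(2) by auto
    have "?A \<inter> perp S = A \<inter> perp S" using x(1) by (auto simp: perp_set_def)
    then have "vec.dim ?A + Suc (vec.dim U) \<le> vec.dim (A \<inter> perp S) + vec.dim S"
      using IH dimU by simp
    then show ?thesis using orth_codim[OF less.prems(1), of x] by linarith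
  qed
qed

text \<open>The generator through \<open>S\<close> that is nearest to the generator \<open>a\<close>.\<close>

definition proj :: "('k ^ 'n) set \<Rightarrow> ('k ^ 'n) set \<Rightarrow> ('k ^ 'n) set" where
  "proj S a = vec.span (S \<union> (a \<inter> perp S))"

lemma subset_proj: "S \<subseteq> proj S a" "a \<inter> perp S \<subseteq> proj S a"
  by (auto simp: proj_def vec.span_base)

text \<open>
  The dimension of the projection is at least \<open>d\<close> by \<open>dim_Int_perp_ge\<close> and at most \<open>d\<close> because it is an
  element; so equality holds throughout, which also gives the dimension of \<open>a \<inter> S\<^sup>\<bottom>\<close>.
\<close>

lemma proj_generator:
  assumes S: "S \<in> P" and a: "a \<in> G"
  shows "proj S a \<in> G"
    and "vec.dim (a \<inter> perp S) + vec.dim S = d + vec.dim (S \<inter> a)"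
proof -
  have sub: "vec.subspace S" "vec.subspace a" "vec.subspace (S \<inter> a)" "vec.subspace (a \<inter> perp S)"
    using S a element_subspace generatorD subspace_perp by auto
  have aP: "a \<inter> perp S \<in> P" using sub by (intro element_down[OF generatorD(1)[OF a]]) auto
  then have "proj S a \<in> P" unfolding proj_def
    using S by (intro element_join) (auto simp: perp_set_def)
  moreover have "a \<subseteq> perp (S \<inter> a)"
    using element_orth[OF generatorD(1)[OF a]] by (auto simp: perp_set_def)
  then have "vec.dim a + vec.dim (S \<inter> a) \<le> vec.dim (a \<inter> perp S) + vec.dim S"
    using sub by (intro dim_Int_perp_ge) auto
  moreover have "S \<inter> (a \<inter> perp S) = S \<inter> a" using element_subset_perp[OF S] by auto
  then have "vec.dim (proj S a) + vec.dim (S \<inter> a) = vec.dim S + vec.dim (a \<inter> perp S)"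
    unfolding proj_def using dim_span_Un[of S "a \<inter> perp S"] sub by simp
  moreover have "vec.dim (proj S a) \<le> d" using \<open>proj S a \<in> P\<close> by (rule element_dim_le)
  ultimately have "proj S a \<in> P" "vec.dim (proj S a) = d"
    "vec.dim (a \<inter> perp S) + vec.dim S = d + vec.dim (S \<inter> a)"
    using generatorD(2)[OF a] by linarith+
  then show "proj S a \<in> G" "vec.dim (a \<inter> perp S) + vec.dim S = d + vec.dim (S \<inter> a)"
    by (auto simp: generators_def)
qed

lemma dim_Int_generators_less:
  assumes "a \<in> G" "b \<in> G" "a \<noteq> b"
  shows "vec.dim (a \<inter> b) < d"
proof (rule ccontr)
  assume "\<not> vec.dim (a \<inter> b) < d"
  then have le: "d \<le> vec.dim (a \<inter> b)" by simp
  have "a \<inter> b = a" "a \<inter> b = b"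
    by (rule subspace_eqI_dim; use assms generatorD le in simp)+
  then show False using assms(3) by simp
qed

definition neighbours :: "('k ^ 'n) set \<Rightarrow> ('k ^ 'n) set \<Rightarrow> ('k ^ 'n) set set" where
  "neighbours S a = {b \<in> G. S \<subseteq> b \<and> vec.dim (a \<inter> b) + 1 = d}"

text \<open>
  A neighbour \<open>b\<close> of \<open>a\<close> that contains \<open>S\<close> meets \<open>a\<close> inside \<open>a \<inter> S\<^sup>\<bottom>\<close>, which has dimension \<open>d - 1\<close>
  here. So \<open>b\<close> contains both \<open>S\<close> and \<open>a \<inter> S\<^sup>\<bottom>\<close>, which span the projection.
\<close>

lemma unique_neighbour:
  assumes S: "S \<in> P" and a: "a \<in> G" and SA: "vec.dim (S \<inter> a) + 1 = vec.dim S"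
  shows "neighbours S a = {proj S a}"
proof -
  have dimp: "vec.dim (a \<inter> perp S) + 1 = d" using proj_generator(2)[OF S a] SA by linarith
  have "proj S a \<noteq> a" using subset_proj(1)[of S a] SA by (auto simp: Int_absorb2)
  then have "vec.dim (a \<inter> proj S a) < d"
    using dim_Int_generators_less[OF a proj_generator(1)[OF S a]] by auto
  moreover have "vec.dim (a \<inter> perp S) \<le> vec.dim (a \<inter> proj S a)"
    using subset_proj(2)[of a S] by (intro vec.dim_subset) auto
  ultimately have "proj S a \<in> neighbours S a"
    using proj_generator(1)[OF S a] subset_proj(1)[of S a] dimp by (simp add: neighbours_def)
  moreover have "b = proj S a" if b: "b \<in> neighbours S a" for b
  proof -
    have bG: "b \<in> G" "S \<subseteq> b" "vec.dim (a \<inter> b) + 1 = d" using b by (auto simp: neighbours_def)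
    have "a \<inter> b \<subseteq> a \<inter> perp S"
      using element_orth[OF generatorD(1)[OF bG(1)]] bG(2) by (auto simp: perp_set_def)
    then have "a \<inter> b = a \<inter> perp S"
      using bG dimp generatorD a subspace_perp by (intro subspace_eqI_dim) auto
    then have "S \<union> (a \<inter> perp S) \<subseteq> b" using bG(2) by auto
    then have "proj S a \<subseteq> b" unfolding proj_def using generatorD(3)[OF bG(1)] by (intro vec.span_minimal)
    then show ?thesis using generator_eqI[OF proj_generator(1)[OF S a] bG(1)] by simp
  qed
  ultimately show ?thesis by blast
qed

lemma dim_Int_of_neighbour:
  assumes S: "S \<in> P" and a: "a \<in> G" and b: "b \<in> neighbours S a" and nsub: "\<not> S \<subseteq> a"
  shows "vec.dim (S \<inter> a) + 1 = vec.dim S"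
proof -
  have bG: "b \<in> G" "S \<subseteq> b" "vec.dim (a \<inter> b) + 1 = d" using b by (auto simp: neighbours_def)
  have sub: "vec.subspace S" "vec.subspace a" "vec.subspace b"
    using S a bG element_subspace generatorD by auto
  have "S \<inter> (a \<inter> b) = S \<inter> a" using bG by auto
  then have "vec.dim S + vec.dim (a \<inter> b) \<le> d + vec.dim (S \<inter> a)"
    using dim_Int_ge[of S "a \<inter> b" b] sub bG generatorD(2) by auto
  moreover have "vec.dim (S \<inter> a) < vec.dim S"
  proof (rule ccontr)
    assume "\<not> ?thesis"
    then have "S \<inter> a = S" using sub by (intro subspace_eqI_dim) auto
    then show False using nsub by auto
  qed
  ultimately show ?thesis using bG(3) by linarith
qed

end

text \<open>The parameter \<open>Qe\<close> is \<open>q\<^sup>e\<close>, where \<open>e\<close> is the type of the polar space.\<close>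

locale regular_polar_geometry = polar_geometry P orth d q
  for P :: "('k::{field,finite} ^ 'n) set set" and orth d q +
  fixes Qe :: real
  assumes thick: "T \<in> P \<Longrightarrow> vec.dim T + 1 = d \<Longrightarrow> real (card {b \<in> G. T \<subseteq> b}) = Qe + 1"
    and Qe_pos: "Qe > 0"
begin

text \<open>
  A neighbour of \<open>a\<close> is determined by the hyperplane of \<open>a\<close> that it contains, up to \<open>Qe\<close> choices.
\<close>

lemma card_neighbours_subset:
  assumes S: "S \<in> P" and a: "a \<in> G" and SA: "S \<subseteq> a"
  shows "real (card (neighbours S a)) = Qe * gauss_number q (d - vec.dim S)"
proof -
  let ?\<H> = "hyperplanes_over S a"
  have sub: "vec.subspace S" "vec.subspace a" "vec.dim a = d"
    using S a element_subspace generatorD by auto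
  have eq: "neighbours S a = (\<Union>H\<in>?\<H>. {b \<in> G. a \<inter> b = H})"
  proof (intro subset_antisym subsetI)
    fix b assume "b \<in> neighbours S a"
    then have b: "b \<in> G" "S \<subseteq> b" "vec.dim (a \<inter> b) + 1 = d" by (auto simp: neighbours_def)
    then have "a \<inter> b \<in> ?\<H>"
      using SA sub generatorD(3)[OF b(1)] by (simp add: hyperplanes_over_def)
    then show "b \<in> (\<Union>H\<in>?\<H>. {b \<in> G. a \<inter> b = H})" using b(1) by blast
  next
    fix b assume "b \<in> (\<Union>H\<in>?\<H>. {b \<in> G. a \<inter> b = H})"
    then have "b \<in> G" "a \<inter> b \<in> ?\<H>" by auto
    then show "b \<in> neighbours S a" using sub(3) by (auto simp: neighbours_def hyperplanes_over_def)
  qed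
  have "card (neighbours S a) = (\<Sum>H\<in>?\<H>. card {b \<in> G. a \<inter> b = H})"
    unfolding eq by (rule card_UN_disjoint) auto
  moreover have "real (card {b \<in> G. a \<inter> b = H}) = Qe" if H: "H \<in> ?\<H>" for H
  proof -
    have H': "vec.subspace H" "H \<subseteq> a" "vec.dim H + 1 = d"
      using H sub by (auto simp: hyperplanes_over_def)
    have "a \<inter> b = H" if b: "b \<in> G" "H \<subseteq> b" "b \<noteq> a" for b
    proof -
      have "vec.dim (a \<inter> b) < d" using dim_Int_generators_less[OF a b(1)] b(3) by auto
      then show ?thesis using H' b sub generatorD(3)[OF b(1)]
        by (intro subspace_eqI_dim[symmetric]) auto
    qed
    moreover have "a \<noteq> H" using H' sub by auto
    ultimately have "{b \<in> G. a \<inter> b = H} = {b \<in> G. H \<subseteq> b} - {a}" by auto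
    then have minus: "card {b \<in> G. a \<inter> b = H} = card ({b \<in> G. H \<subseteq> b} - {a})" by (rule arg_cong)
    have mem: "a \<in> {b \<in> G. H \<subseteq> b}" using a H' by auto
    then have "card {b \<in> G. H \<subseteq> b} = Suc (card ({b \<in> G. H \<subseteq> b} - {a}))"
      by (intro card.remove) auto
    moreover have "H \<in> P" using H' by (intro element_down[OF generatorD(1)[OF a]]) auto
    then have "real (card {b \<in> G. H \<subseteq> b}) = Qe + 1" using H'(3) by (rule thick)
    ultimately show ?thesis unfolding minus by linarith
  qed
  ultimately show ?thesis using card_hyperplanes_over[OF sub(1,2) SA] sub(3) by (simp add: q_card)
qed

lemma card_neighbours:
  assumes S: "S \<in> P" and a: "a \<in> G"
  shows "real (card (neighbours S a)) =
    (if S \<subseteq> a then Qe * gauss_number q (d - vec.dim S)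
     else of_bool (vec.dim (S \<inter> a) + 1 = vec.dim S))"
proof (cases "S \<subseteq> a")
  case True
  then show ?thesis using card_neighbours_subset[OF S a] by simp
next
  case False
  show ?thesis
  proof (cases "vec.dim (S \<inter> a) + 1 = vec.dim S")
    case True
    then show ?thesis using unique_neighbour[OF S a] False by simp
  next
    case nd: False
    then have "neighbours S a = {}" using dim_Int_of_neighbour[OF S a] False by blast
    then show ?thesis using False nd by simp
  qed
qed

lemma card_hyperplanes_inside:
  assumes S: "S \<in> P" and a: "a \<in> G"
  shows "real (card {T \<in> hyperplanes_over {0} S. T \<subseteq> a}) =
    (if S \<subseteq> a then gauss_number q (vec.dim S)
     else of_bool (vec.dim (S \<inter> a) + 1 = vec.dim S))"
proof (cases "S \<subseteq> a")
  case True
  then have "{T \<in> hyperplanes_over {0} S. T \<subseteq> a} = hyperplanes_over {0} S"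
    by (auto simp: hyperplanes_over_def)
  moreover have "vec.subspace S" using S by (rule element_subspace)
  ultimately show ?thesis
    using True card_hyperplanes_over[of "{0}" S] by (simp add: q_card)
next
  case False
  have sub: "vec.subspace S" "vec.subspace (S \<inter> a)"
    using S a element_subspace generatorD by auto
  have lt: "vec.dim (S \<inter> a) < vec.dim S"
  proof (rule ccontr)
    assume "\<not> ?thesis"
    then have "S \<inter> a = S" using sub by (intro subspace_eqI_dim) auto
    then show False using False by auto
  qed
  have T: "T = S \<inter> a \<and> vec.dim (S \<inter> a) + 1 = vec.dim S"
    if "T \<in> hyperplanes_over {0} S" "T \<subseteq> a" for T
  proof -
    have *: "vec.subspace T" "T \<subseteq> S \<inter> a" "vec.dim T + 1 = vec.dim S"
      using that by (auto simp: hyperplanes_over_def)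
    moreover have "T = S \<inter> a" using * lt sub by (intro subspace_eqI_dim) auto
    ultimately show ?thesis by simp
  qed
  show ?thesis
  proof (cases "vec.dim (S \<inter> a) + 1 = vec.dim S")
    case True
    then have "S \<inter> a \<in> hyperplanes_over {0} S"
      using sub generatorD(3)[OF a] by (auto simp: hyperplanes_over_def)
    then have "{T \<in> hyperplanes_over {0} S. T \<subseteq> a} = {S \<inter> a}" using T by blast
    then show ?thesis using False True by simp
  next
    case nd: False
    then have "{T \<in> hyperplanes_over {0} S. T \<subseteq> a} = {}" using T by blast
    then show ?thesis using False nd by (simp only: card.empty) simp
  qed
qed

text \<open>
  The number of generators opposite to a given one in rank \<open>m\<close>; for \<open>m = d\<close> it is the valency of \<open>A\<^sub>d\<close>.
\<close>

definition opposite_number :: "nat \<Rightarrow> real" where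
  "opposite_number m = q ^ (m choose 2) * Qe ^ m"

lemma opposite_number_Suc: "opposite_number (Suc m) = Qe * q ^ m * opposite_number m"
  by (simp add: opposite_number_def numeral_2_eq_2 power_add)

text \<open>
  Induction on the corank of \<open>S\<close>, counting pairs \<open>(x, b)\<close> with \<open>b\<close> an opposite generator over \<open>S\<close> and
  \<open>x\<close> a vector of \<open>b\<close> outside \<open>S\<close>. The possible \<open>x\<close> are the vectors that extend \<open>S\<close> to an element not
  contained in the projection of \<open>S\<close> onto \<open>a\<close>: for these the larger element still meets \<open>a\<close> trivially.
\<close>

lemma card_opposite:
  assumes "S \<in> P" "a \<in> G" "S \<inter> a = {0}"
  shows "real (card {b \<in> G. S \<subseteq> b \<and> b \<inter> a = {0}}) = opposite_number (d - vec.dim S)"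
  using assms
proof (induction "d - vec.dim S" arbitrary: S)
  case 0
  have dimS: "vec.dim S = d" using 0 element_dim_le[of S] by linarith
  then have SG: "S \<in> G" using 0 by (simp add: generators_def)
  then have "{b \<in> G. S \<subseteq> b \<and> b \<inter> a = {0}} = {S}"
    using generator_eqI[OF SG] 0 by auto
  then show ?case using dimS by (simp add: opposite_number_def numeral_2_eq_2)
next
  case (Suc m)
  note S = \<open>S \<in> P\<close> and a = \<open>a \<in> G\<close> and disj = \<open>S \<inter> a = {0}\<close>
  let ?p = "proj S a" and ?S = "\<lambda>x. vec.span (insert x S)"
  let ?N = "{b \<in> G. S \<subseteq> b \<and> b \<inter> a = {0}}"
  define X where "X = {x \<in> perp S. ?S x \<in> P \<and> x \<notin> ?p}"
  have p: "?p \<in> G" "S \<subseteq> ?p" using proj_generator(1)[OF S a] subset_proj(1) by auto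
  have sub: "vec.subspace S" "vec.subspace a" "vec.subspace ?p"
    using S a p element_subspace generatorD by auto
  define j where "j = vec.dim S"
  have dj: "d = j + Suc m" using Suc.hyps(2) unfolding j_def by linarith
  have X_notin: "x \<notin> S" if "x \<in> X" for x using that p(2) by (auto simp: X_def)
  have dimS: "vec.dim (?S x) = Suc j" if "x \<notin> S" for x
    using dim_insert_subspace[OF sub(1) that] by (simp add: j_def)
  have notin_iff: "?S x \<subseteq> b \<longleftrightarrow> S \<subseteq> b \<and> x \<in> b" if "b \<in> G" for b x
    using generatorD(3)[OF that] subset_span_insert(1)[of S x] subset_span_insert(2)[of x S]
      span_insert_subset[of b S x] by blast
  \<comment> \<open>The vectors of \<open>X\<close> are partitioned by the neighbours of the projection that contain \<open>S\<close>.\<close>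
  have cardX: "real (card X) = Qe * gauss_number q (Suc m) * (q ^ d - q ^ (d - 1))"
  proof -
    have one: "card {b \<in> neighbours S ?p. x \<in> b} = 1" if x: "x \<in> X" for x
    proof -
      have xs: "?S x \<in> P" "x \<notin> ?p" using x by (auto simp: X_def)
      have "?S x \<inter> ?p = S"
      proof (rule subspace_eqI_dim[symmetric])
        have "?S x \<inter> ?p \<noteq> ?S x" using xs(2) subset_span_insert(2)[of x S] by blast
        then have "vec.dim (?S x \<inter> ?p) \<noteq> vec.dim (?S x)"
          using vec.subspace_dim_equal[of "?S x \<inter> ?p" "?S x"] sub(3) by auto
        moreover have "vec.dim (?S x \<inter> ?p) \<le> vec.dim (?S x)" by (rule vec.dim_subset) auto
        ultimately show "vec.dim (?S x \<inter> ?p) \<le> vec.dim S"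
          using dimS[OF X_notin[OF x]] by (simp add: j_def)
      qed (use sub p(2) subset_span_insert(1)[of S x] in auto)
      then have "neighbours (?S x) ?p = {proj (?S x) ?p}"
        using unique_neighbour[OF xs(1) p(1)] dimS[OF X_notin[OF x]] by (simp add: j_def)
      moreover have "neighbours (?S x) ?p = {b \<in> neighbours S ?p. x \<in> b}"
        using notin_iff by (auto simp: neighbours_def)
      ultimately show ?thesis by simp
    qed
    have two: "card {x \<in> X. x \<in> b} = CARD('k) ^ d - CARD('k) ^ (d - 1)" if b: "b \<in> neighbours S ?p" for b
    proof -
      have bG: "b \<in> G" "S \<subseteq> b" "vec.dim (?p \<inter> b) = d - 1" using b by (auto simp: neighbours_def)
      have "{x \<in> X. x \<in> b} = b - ?p \<inter> b"
      proof -
        have "x \<in> X" if "x \<in> b" "x \<notin> ?p" for x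
          using that bG element_orth[OF generatorD(1)[OF bG(1)]] notin_iff[OF bG(1)]
            element_down[OF generatorD(1)[OF bG(1)], of "?S x"]
          by (auto simp: X_def perp_set_def)
        then show ?thesis by (auto simp: X_def)
      qed
      then show ?thesis
        using card_Diff_subset[of "?p \<inter> b" b] card_subspace[of b] card_subspace[of "?p \<inter> b"]
          bG generatorD[OF bG(1)] sub(3) by auto
    qed
    have "card X = (\<Sum>x\<in>X. card {b \<in> neighbours S ?p. x \<in> b})" using one by simp
    also have "\<dots> = (\<Sum>b\<in>neighbours S ?p. CARD('k) ^ d - CARD('k) ^ (d - 1))"
      by (rule sum_multicount_gen) (use two in auto)
    finally have "card X = card (neighbours S ?p) * (CARD('k) ^ d - CARD('k) ^ (d - 1))" by simp
    moreover have "CARD('k) ^ (d - 1) \<le> CARD('k) ^ d"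
      using CARD_field_ge2[where 'k = 'k] by (intro power_increasing) auto
    ultimately have "real (card X) = real (card (neighbours S ?p)) * (q ^ d - q ^ (d - 1))"
      by (simp add: of_nat_diff q_card)
    moreover have "d - vec.dim S = Suc m" using Suc.hyps(2) by simp
    ultimately show ?thesis using card_neighbours_subset[OF S p] by simp
  qed
  have "real (card {b \<in> ?N. x \<in> b}) = opposite_number m" if x: "x \<in> X" for x
  proof -
    have "{b \<in> ?N. x \<in> b} = {b \<in> G. ?S x \<subseteq> b \<and> b \<inter> a = {0}}"
      using notin_iff by blast
    moreover have "?S x \<inter> a = {0}"
    proof -
      have "v = 0" if v: "v \<in> ?S x" "v \<in> a" for v
      proof -
        obtain c where c: "v - c *s x \<in> S"
          using v(1) sub(1) by (auto simp: vec.span_breakdown_eq vec.span_eq_iff[THEN iffD2])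
        have xp: "x \<in> perp S" "x \<notin> ?p" using x by (auto simp: X_def)
        have "v - c *s x \<in> perp S" using c element_subset_perp[OF S] by auto
        moreover have "c *s x \<in> perp S" using xp subspace_perp vec.subspace_scale by blast
        ultimately have "v - c *s x + c *s x \<in> perp S" using subspace_perp vec.subspace_add by blast
        then have "v \<in> ?p" using v(2) subset_proj(2)[of a S] by auto
        then have "v - (v - c *s x) \<in> ?p" using c p(2) sub(3) vec.subspace_diff by blast
        then have cx: "c *s x \<in> ?p" by simp
        have "c = 0"
        proof (rule ccontr)
          assume "c \<noteq> 0"
          then have "inverse c * c = 1" by simp
          then have "x = inverse c *s (c *s x)" by (simp only: vec.scale_scale vec.scale_one)
          then show False using vec.subspace_scale[OF sub(3) cx, of "inverse c"] xp(2) by simp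
        qed
        then have "v \<in> S \<inter> a" using c v(2) by simp
        then show "v = 0" using disj by simp
      qed
      then show ?thesis using sub(2) vec.subspace_0[of a] vec.span_zero[of "insert x S"] by auto
    qed
    moreover have "m = d - vec.dim (?S x)" using dimS[OF X_notin[OF x]] dj by simp
    moreover have "?S x \<in> P" using x by (simp add: X_def)
    ultimately show ?thesis using Suc.hyps(1)[of "?S x"] a by simp
  qed
  moreover have "real (card {x \<in> X. x \<in> b}) = q ^ d - q ^ j" if b: "b \<in> ?N" for b
  proof -
    have bG: "b \<in> G" "S \<subseteq> b" "b \<inter> a = {0}" using b by auto
    have "x \<in> X" if x: "x \<in> b" "x \<notin> S" for x
    proof -
      have "x \<notin> ?p"
      proof
        assume "x \<in> ?p"
        then obtain s y where sy: "x = s + y" "s \<in> S" "y \<in> a \<inter> perp S"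
          using sub subspace_perp
          by (auto simp: proj_def vec.span_Un vec.span_eq_iff[THEN iffD2])
        then have "y = x - s" by simp
        then have "y \<in> b" using sy bG x generatorD(3) vec.subspace_diff by blast
        then have "y = 0" using sy bG(3) by auto
        then show False using sy x by simp
      qed
      then show ?thesis
        using x bG element_orth[OF generatorD(1)[OF bG(1)]] notin_iff[OF bG(1)]
          element_down[OF generatorD(1)[OF bG(1)], of "?S x"]
        by (auto simp: X_def perp_set_def)
    qed
    then have "{x \<in> X. x \<in> b} = b - S" using X_notin by auto
    then show ?thesis
      using card_subspace_diff_q[of b S] bG generatorD[OF bG(1)] sub(1) by (simp add: j_def)
  qed
  moreover have "(\<Sum>b\<in>?N. card {x \<in> X. x \<in> b}) = (\<Sum>x\<in>X. card {b \<in> ?N. x \<in> b})"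
    by (rule sum_multicount_gen) auto
  then have "(\<Sum>b\<in>?N. real (card {x \<in> X. x \<in> b})) = (\<Sum>x\<in>X. real (card {b \<in> ?N. x \<in> b}))"
    by (simp flip: of_nat_sum)
  ultimately have "real (card ?N) * (q ^ d - q ^ j) = real (card X) * opposite_number m" by simp
  also have "\<dots> = (Qe * q ^ m * opposite_number m) * (q ^ d - q ^ j)"
  proof -
    have pows: "q ^ d = q ^ j * (q * q ^ m)" "q ^ (d - 1) = q ^ j * q ^ m"
      unfolding dj by (simp_all add: power_add)
    have "gauss_number q (Suc m) * (q - 1) = q * q ^ m - 1"
      using q_ge2 by (simp add: gauss_number_def)
    then have diff: "q ^ d - q ^ j = q ^ j * (gauss_number q (Suc m) * (q - 1))"
      unfolding pows by (simp add: right_diff_distrib)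
    show ?thesis unfolding cardX diff unfolding pows by (simp add: algebra_simps)
  qed
  finally have "real (card ?N) * (q ^ d - q ^ j) = opposite_number (Suc m) * (q ^ d - q ^ j)"
    by (simp add: opposite_number_Suc)
  moreover have "q ^ j < q ^ d" using q_ge2 dj by (intro power_strict_increasing) auto
  moreover have "Suc m = d - vec.dim S" by (rule Suc.hyps(2))
  ultimately show ?case by simp
qed

text \<open>
  A generator \<open>b\<close> off the point \<open>p\<close> has exactly one neighbour on \<open>p\<close>. Conversely a generator \<open>c\<close> on \<open>p\<close> has
  \<open>Qe ([d] - [d - 1]) = Qe q\<^sup>d\<^sup>-\<^sup>1\<close> neighbours off \<open>p\<close>.
\<close>

lemma card_generators_point:
  assumes p: "p \<in> P" "vec.dim p = 1"
  shows "real (card G) = (q ^ (d - 1) * Qe + 1) * real (card {g \<in> G. p \<subseteq> g})"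
proof -
  let ?Np = "{g \<in> G. p \<subseteq> g}" and ?Nn = "{g \<in> G. \<not> p \<subseteq> g}"
  have d1: "d \<ge> 1" using element_dim_le[OF p(1)] p(2) by simp
  have "card {c \<in> ?Np. vec.dim (b \<inter> c) + 1 = d} = 1" if b: "b \<in> ?Nn" for b
  proof -
    have bG: "b \<in> G" "\<not> p \<subseteq> b" using b by auto
    have "vec.dim (p \<inter> b) < vec.dim p"
    proof (rule ccontr)
      assume "\<not> ?thesis"
      then have "p \<inter> b = p"
        using element_subspace[OF p(1)] generatorD(3)[OF bG(1)]
        by (intro subspace_eqI_dim) auto
      then show False using bG by auto
    qed
    then have "neighbours p b = {proj p b}" using unique_neighbour[OF p(1) bG(1)] p(2) by simp
    moreover have "neighbours p b = {c \<in> ?Np. vec.dim (b \<inter> c) + 1 = d}"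
      by (auto simp: neighbours_def)
    ultimately show ?thesis by simp
  qed
  then have "card ?Nn = (\<Sum>b\<in>?Nn. card {c \<in> ?Np. vec.dim (b \<inter> c) + 1 = d})" by simp
  also have "\<dots> = (\<Sum>c\<in>?Np. card {b \<in> ?Nn. vec.dim (b \<inter> c) + 1 = d})"
    by (rule sum_multicount_gen) auto
  finally have "real (card ?Nn) = (\<Sum>c\<in>?Np. real (card {b \<in> ?Nn. vec.dim (b \<inter> c) + 1 = d}))" by simp
  also have "\<dots> = (\<Sum>c\<in>?Np. Qe * q ^ (d - 1))"
  proof (rule sum.cong[OF refl])
    fix c assume "c \<in> ?Np"
    then have c: "c \<in> G" "p \<subseteq> c" by auto
    have sub: "neighbours p c \<subseteq> neighbours {0} c"
      using element_subspace[OF p(1)] by (auto simp: neighbours_def)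
    have "{b \<in> ?Nn. vec.dim (b \<inter> c) + 1 = d} = neighbours {0} c - neighbours p c"
      using generatorD(3) by (auto simp: neighbours_def Int_commute)
    then have "real (card {b \<in> ?Nn. vec.dim (b \<inter> c) + 1 = d})
        = real (card (neighbours {0} c)) - real (card (neighbours p c))"
      using sub by (simp add: card_Diff_subset of_nat_diff card_mono)
    also have "\<dots> = Qe * (gauss_number q d - gauss_number q (d - 1))"
      using card_neighbours_subset[OF zero_element c(1)] card_neighbours_subset[OF p(1) c] p(2)
        generatorD(3)[OF c(1)]
      by (simp add: right_diff_distrib)
    also have "gauss_number q d - gauss_number q (d - 1) = q ^ (d - 1)"
      using gauss_number_Suc[of q "d - 1"] q_ge2 d1 by simp
    finally show "real (card {b \<in> ?Nn. vec.dim (b \<inter> c) + 1 = d}) = Qe * q ^ (d - 1)" .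
  qed
  also have "\<dots> = real (card ?Np) * (Qe * q ^ (d - 1))" by simp
  finally have "real (card ?Nn) = real (card ?Np) * (Qe * q ^ (d - 1))" .
  moreover have "card (?Np \<union> ?Nn) = card ?Np + card ?Nn"
    by (rule card_Un_disjoint) auto
  moreover have "?Np \<union> ?Nn = G" by auto
  ultimately show ?thesis by (simp add: algebra_simps)
qed

end

section \<open>The filtration of functions on generators\<close>

lemma sum_of_bool_eq_card:
  assumes "finite A"
  shows "(\<Sum>x\<in>A. of_bool (R x)) = real (card {x \<in> A. R x})"
  using assms unfolding of_bool_def by (subst sum.inter_filter[symmetric]) auto

context regular_polar_geometry
begin

text \<open>
  The type of all sets of vectors is finite, so functions on generators are vectors of a Euclidean space
  indexed by that type, vanishing off the generators.
\<close>

definition contains_vec :: "('k ^ 'n) set \<Rightarrow> real ^ (('k ^ 'n) set)" where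
  "contains_vec S = (\<chi> g. of_bool (g \<in> G \<and> S \<subseteq> g))"

text \<open>
  The inequality is strict so that the chain starts with the zero space; the \<open>r\<close>-th layer then belongs to
  the elements of dimension \<open>r\<close>.
\<close>

definition filtration :: "nat \<Rightarrow> (real ^ (('k ^ 'n) set)) set" where
  "filtration r = span (contains_vec ` {S \<in> P. vec.dim S < r})"

definition generator_op :: "nat \<Rightarrow> real ^ (('k ^ 'n) set) \<Rightarrow> real ^ (('k ^ 'n) set)" where
  "generator_op i v = (\<chi> a. if a \<in> G then \<Sum>b\<in>G. adj_matrix d i a b * v $ b else 0)"

definition meets_vec :: "('k ^ 'n) set \<Rightarrow> ('k ^ 'n) set \<Rightarrow> real ^ (('k ^ 'n) set)" where
  "meets_vec U S = (\<chi> a. of_bool (a \<in> G \<and> S \<inter> a = U))"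

lemma subspace_chain_filtration: "subspace_chain filtration"
proof
  show "subspace (filtration r)" for r by (simp add: filtration_def)
  show "filtration r \<subseteq> filtration s" if "r \<le> s" for r s
    unfolding filtration_def using that by (intro span_mono image_mono) auto
  show "filtration 0 = {0}" by (simp add: filtration_def)
qed

sublocale subspace_chain filtration by (rule subspace_chain_filtration)

lemma contains_vec_in: "S \<in> P \<Longrightarrow> vec.dim S < r \<Longrightarrow> contains_vec S \<in> filtration r"
  unfolding filtration_def by (intro span_base) auto

lemma linear_generator_op: "linear (generator_op i)"
  by (rule linearI)
    (auto simp: generator_op_def vec_eq_iff distrib_left sum.distrib sum_distrib_left mult.left_commute)

lemma generator_op_selfadjoint: "generator_op i u \<bullet> v = u \<bullet> generator_op i v"
proof -
  have rep: "generator_op i x \<bullet> y = (\<Sum>a\<in>G. \<Sum>b\<in>G. adj_matrix d i a b * x $ b * y $ a)" for x y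
  proof -
    have "generator_op i x \<bullet> y = (\<Sum>a\<in>UNIV. if a \<in> G then (\<Sum>b\<in>G. adj_matrix d i a b * x $ b * y $ a) else 0)"
      by (auto simp: inner_vec_def generator_op_def sum_distrib_right intro!: sum.cong)
    also have "\<dots> = (\<Sum>a\<in>G. \<Sum>b\<in>G. adj_matrix d i a b * x $ b * y $ a)"
      by (simp add: sum.If_cases)
    finally show ?thesis .
  qed
  have "adj_matrix d i a b = adj_matrix d i b a" for a b :: "('k ^ 'n) set"
    by (simp add: adj_matrix_def Int_commute)
  then have "(\<Sum>a\<in>G. \<Sum>b\<in>G. adj_matrix d i a b * u $ b * v $ a)
      = (\<Sum>a\<in>G. \<Sum>b\<in>G. adj_matrix d i b a * v $ a * u $ b)"
    by (simp add: mult.commute mult.left_commute)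
  also have "\<dots> = (\<Sum>a\<in>G. \<Sum>b\<in>G. adj_matrix d i a b * v $ b * u $ a)"
    by (rule sum.swap)
  finally have "generator_op i u \<bullet> v = generator_op i v \<bullet> u" unfolding rep .
  then show ?thesis by (simp add: inner_commute)
qed

text \<open>A generator contains no other generator, so \<open>contains_vec g\<close> is a unit vector for every generator \<open>g\<close>.\<close>

lemma supported_in_filtration:
  assumes "\<And>a. a \<notin> G \<Longrightarrow> v $ a = 0"
  shows "v \<in> filtration (Suc d)"
proof -
  have "contains_vec g $ a = of_bool (a = g)" if "g \<in> G" for g a
    using that generator_eqI[OF that, of a] by (auto simp: contains_vec_def)
  then have "(\<Sum>g\<in>G. v $ g *\<^sub>R contains_vec g) $ a = (\<Sum>g\<in>G. if a = g then v $ g else 0)" for a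
    by (auto intro!: sum.cong)
  then have "v = (\<Sum>g\<in>G. v $ g *\<^sub>R contains_vec g)"
    using assms by (simp add: vec_eq_iff)
  also have "\<dots> \<in> filtration (Suc d)"
    using chain_subspace[of "Suc d"] generatorD
    by (intro subspace_sum subspace_scale contains_vec_in) auto
  finally show ?thesis .
qed

text \<open>
  A generating vector of smaller dimension than \<open>r\<close> already lies in \<open>filtration r\<close>, so there the diagonal
  coefficient may be replaced by \<open>c r\<close>.
\<close>

lemma triangularI:
  assumes L: "linear L"
    and tri: "\<And>S. S \<in> P \<Longrightarrow> L (contains_vec S) - c (vec.dim S) *\<^sub>R contains_vec S \<in> filtration (vec.dim S)"
    and u: "u \<in> filtration (Suc r)"
  shows "L u - c r *\<^sub>R u \<in> filtration r"
  using u unfolding filtration_def[of "Suc r"]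
proof (induction u rule: span_induct_alt)
  case base
  then show ?case using linear_0[OF L] subspace_0[OF chain_subspace[of r]] by simp
next
  case (step t x y)
  have "L x - c r *\<^sub>R x \<in> filtration r"
  proof -
    obtain S where S: "S \<in> P" "vec.dim S < Suc r" "x = contains_vec S" using step by auto
    show ?thesis
    proof (cases "vec.dim S = r")
      case True
      then show ?thesis using tri[OF S(1)] S(3) by simp
    next
      case False
      then have lt: "vec.dim S < r" using S(2) by simp
      have x: "x \<in> filtration r" using S(1,3) lt by (simp add: contains_vec_in)
      have "L x - c (vec.dim S) *\<^sub>R x \<in> filtration r"
        using tri[OF S(1)] S(3) chain_mono[of "vec.dim S" r] lt by auto
      then have "(L x - c (vec.dim S) *\<^sub>R x) + (c (vec.dim S) - c r) *\<^sub>R x \<in> filtration r"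
        using x chain_subspace subspace_add subspace_scale by blast
      then show ?thesis by (simp add: algebra_simps)
    qed
  qed
  then have "t *\<^sub>R (L x - c r *\<^sub>R x) + (L y - c r *\<^sub>R y) \<in> filtration r"
    using step chain_subspace[of r] by (intro subspace_add subspace_scale) auto
  then show ?case
    by (simp add: linear_add[OF L] linear_scale[OF L] algebra_simps)
qed

abbreviation "adjacency_eigenvalue r \<equiv> Qe * gauss_number q (d - r) - gauss_number q r"

text \<open>
  At a generator \<open>a\<close> not containing \<open>S\<close>, both sides are \<open>1\<close> or \<open>0\<close> according to whether \<open>a\<close> meets \<open>S\<close> in a
  hyperplane of \<open>S\<close>. At \<open>a \<supseteq> S\<close> there are \<open>Qe [d - j]\<close> neighbours over \<open>S\<close>, and all \<open>[j]\<close> hyperplanes of \<open>S\<close>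
  contribute to the sum on the right.
\<close>

lemma adjacency_contains_vec:
  assumes d: "d \<ge> 1" and S: "S \<in> P"
  shows "generator_op 1 (contains_vec S)
    = adjacency_eigenvalue (vec.dim S) *\<^sub>R contains_vec S + (\<Sum>T\<in>hyperplanes_over {0} S. contains_vec T)"
proof (subst vec_eq_iff, intro allI)
  fix a
  show "generator_op 1 (contains_vec S) $ a =
    (adjacency_eigenvalue (vec.dim S) *\<^sub>R contains_vec S + (\<Sum>T\<in>hyperplanes_over {0} S. contains_vec T)) $ a"
  proof (cases "a \<in> G")
    case False
    then show ?thesis by (simp add: generator_op_def contains_vec_def)
  next
    case a: True
    have "generator_op 1 (contains_vec S) $ a = (\<Sum>b\<in>G. adj_matrix d 1 a b * contains_vec S $ b)"
      using a by (simp add: generator_op_def)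
    also have "\<dots> = (\<Sum>b\<in>G. of_bool (S \<subseteq> b \<and> vec.dim (a \<inter> b) + 1 = d))"
      using d by (intro sum.cong refl) (auto simp: contains_vec_def adj_matrix_def)
    also have "\<dots> = real (card (neighbours S a))"
      unfolding neighbours_def by (rule sum_of_bool_eq_card) simp
    finally have lhs: "generator_op 1 (contains_vec S) $ a = real (card (neighbours S a))" .
    have "(\<Sum>T\<in>hyperplanes_over {0} S. contains_vec T) $ a
        = (\<Sum>T\<in>hyperplanes_over {0} S. of_bool (T \<subseteq> a))"
      using a by (simp add: contains_vec_def)
    also have "\<dots> = real (card {T \<in> hyperplanes_over {0} S. T \<subseteq> a})"
      by (rule sum_of_bool_eq_card) simp
    finally show ?thesis
      using lhs card_neighbours[OF S a] card_hyperplanes_inside[OF S a] a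
      by (simp add: contains_vec_def)
  qed
qed

text \<open>
  For a hyperplane \<open>S'\<close> of \<open>S\<close> over \<open>U\<close>, the generators that meet \<open>S'\<close> in \<open>U\<close> meet \<open>S\<close> in \<open>U\<close> or in
  some \<open>U + \<langle>y\<rangle>\<close> with \<open>y \<in> S - S'\<close>, each such subspace arising from \<open>q\<^sup>u\<^sup>+\<^sup>1 - q\<^sup>u\<close> vectors \<open>y\<close>, where
  \<open>u = dim U\<close>. The vector for \<open>S'\<close> lies in a lower term of the filtration, and the other subspaces have smaller
  codimension in \<open>S\<close>; so the coefficient gets the factor \<open>- (q\<^sup>j - q\<^sup>j\<^sup>-\<^sup>1) / (q\<^sup>u\<^sup>+\<^sup>1 - q\<^sup>u) = - q\<^sup>m\<close> with \<open>j = dim S\<close>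
  when the codimension grows from \<open>m\<close> to \<open>m + 1\<close>.
\<close>

lemma meets_vec_coefficient:
  assumes "S \<in> P" "vec.subspace U" "U \<subseteq> S" "vec.dim S = vec.dim U + m"
  shows "meets_vec U S - ((-1) ^ m * q ^ (m choose 2)) *\<^sub>R contains_vec S \<in> filtration (vec.dim S)"
  using assms
proof (induction m arbitrary: U S)
  case 0
  have "U = S" using 0 element_subspace by (intro subspace_eqI_dim) auto
  then have "meets_vec U S = contains_vec S"
    by (auto simp: meets_vec_def contains_vec_def vec_eq_iff)
  then show ?case using subspace_0[OF chain_subspace] by (simp add: numeral_2_eq_2)
next
  case (Suc m)
  define u where "u = vec.dim U"
  define j where "j = vec.dim S"
  note S = Suc.prems(1) and U = Suc.prems(2,3)
  have ju: "j = u + Suc m" using Suc.prems(4) by (simp add: u_def j_def)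
  have sS: "vec.subspace S" using S by (rule element_subspace)
  let ?c = "\<lambda>m. (-1) ^ m * q ^ (m choose 2)"
  let ?U = "\<lambda>y. vec.span (insert y U)"
  have "real (card (hyperplanes_over U S)) = gauss_number q (Suc m)"
    using card_hyperplanes_over[of U S] U sS Suc.prems(4) by (simp add: q_card)
  moreover have "gauss_number q (Suc m) > 0"
    using q_ge2 one_less_power[of q "Suc m"] by (auto simp: gauss_number_def)
  ultimately have "hyperplanes_over U S \<noteq> {}" by auto
  then obtain S' where S': "vec.subspace S'" "U \<subseteq> S'" "S' \<subseteq> S" "vec.dim S' + 1 = j"
    by (auto simp: hyperplanes_over_def j_def)
  have S'P: "S' \<in> P" using element_down[OF S S'(1,3)] .
  define D where "D = q ^ Suc u - q ^ u"
  have D: "D > 0" using q_ge2 by (simp add: D_def)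
  have dimU: "vec.dim (?U y) = Suc u" if "y \<in> S - S'" for y
    using that S'(2) dim_insert_subspace[OF U(1), of y] by (auto simp: u_def)
  have UyS: "?U y \<subseteq> S" if "y \<in> S - S'" for y
    using that U sS by (intro span_insert_subset) auto
  have UyS': "?U y \<inter> S' \<subseteq> U" if y: "y \<in> S - S'" for y
  proof
    fix v assume v: "v \<in> ?U y \<inter> S'"
    then obtain c where c: "v - c *s y \<in> U"
      using U(1) by (auto simp: vec.span_breakdown_eq vec.span_eq_iff[THEN iffD2])
    have "c = 0"
    proof (rule ccontr)
      assume "c \<noteq> 0"
      then have "inverse c * c = 1" by simp
      moreover have "v - (v - c *s y) \<in> S'" using c v S' vec.subspace_diff by blast
      then have "c *s y \<in> S'" by simp
      then have "inverse c *s (c *s y) \<in> S'" by (rule vec.subspace_scale[OF S'(1)])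
      ultimately have "y \<in> S'" by (simp only: vec.scale_scale vec.scale_one)
      then show False using y by simp
    qed
    then show "v \<in> U" using c by simp
  qed
  have count: "meets_vec U S' = meets_vec U S + (1 / D) *\<^sub>R (\<Sum>y\<in>S - S'. meets_vec (?U y) S)"
  proof (subst vec_eq_iff, intro allI)
    fix a
    let ?Y = "{y \<in> S - S'. S \<inter> a = ?U y}"
    have sum: "(\<Sum>y\<in>S - S'. meets_vec (?U y) S) $ a = of_bool (a \<in> G) * real (card ?Y)"
      by (simp add: meets_vec_def Collect_conj_eq set_diff_eq Int_assoc)
    show "meets_vec U S' $ a = (meets_vec U S + (1 / D) *\<^sub>R (\<Sum>y\<in>S - S'. meets_vec (?U y) S)) $ a"
    proof (cases "a \<in> G")
      case False
      then show ?thesis using sum by (simp add: meets_vec_def)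
    next
      case a: True
      have sa: "vec.subspace a" using generatorD(3)[OF a] .
      consider (in_U) "S \<inter> a = U" | (bigger) "S \<inter> a \<noteq> U" "S' \<inter> a = U" | (other) "S' \<inter> a \<noteq> U" by blast
      then show ?thesis
      proof cases
        case in_U
        then have "S' \<inter> a = U" using S' by auto
        moreover have "?Y = {}"
          using in_U S'(2) subset_span_insert(2)[where S = U] by auto
        ultimately show ?thesis using in_U sum a by (simp add: meets_vec_def)
      next
        case bigger
        have "U \<subseteq> S \<inter> a" using bigger(2) S'(3) by auto
        then have "u < vec.dim (S \<inter> a)"
          using bigger(1) subspace_eqI_dim[of U "S \<inter> a"] U(1) sS sa by (force simp: u_def)
        moreover have "S' \<inter> (S \<inter> a) = U" using bigger(2) S'(3) by auto
        then have "vec.dim S' + vec.dim (S \<inter> a) \<le> j + u"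
          using dim_Int_ge[of S' "S \<inter> a" S] S' sS sa by (simp add: j_def u_def)
        ultimately have dimSa: "vec.dim (S \<inter> a) = Suc u" using S'(4) by linarith
        have "?Y = (S \<inter> a) - U"
        proof (intro subset_antisym subsetI)
          fix y assume "y \<in> ?Y"
          then show "y \<in> (S \<inter> a) - U" using subset_span_insert(2)[of y U] S'(2) by auto
        next
          fix y assume y: "y \<in> (S \<inter> a) - U"
          then have yS: "y \<in> S - S'" using bigger(2) by auto
          have "?U y \<subseteq> S \<inter> a" using y \<open>U \<subseteq> S \<inter> a\<close> sS sa by (intro span_insert_subset) auto
          then have "?U y = S \<inter> a"
            using dimU[OF yS] dimSa sS sa by (intro subspace_eqI_dim) auto
          then show "y \<in> ?Y" using yS by simp
        qed
        then have "real (card ?Y) = D"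
          using card_subspace_diff_q[of "S \<inter> a" U] \<open>U \<subseteq> S \<inter> a\<close> sS sa U(1) dimSa
          by (simp add: D_def u_def)
        then show ?thesis using bigger sum a D by (simp add: meets_vec_def)
      next
        case other
        have "?Y = {}"
        proof -
          have False if y: "y \<in> ?Y" for y
          proof -
            have "S' \<inter> a = ?U y \<inter> S'" using y S'(3) by auto
            moreover have "U \<subseteq> ?U y \<inter> S'" using S'(2) subset_span_insert(1)[of U y] by auto
            ultimately show False using UyS'[of y] y other by blast
          qed
          then show ?thesis by blast
        qed
        moreover have "S \<inter> a \<noteq> U" using other S' by auto
        ultimately show ?thesis using other sum a by (simp add: meets_vec_def)
      qed
    qed
  qed
  let ?F = "filtration j"
  note F = chain_subspace[of j]
  have "meets_vec U S' - ?c m *\<^sub>R contains_vec S' \<in> filtration (vec.dim S')"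
    using Suc.IH[OF S'P U(1) S'(2)] S'(4) ju by (simp add: u_def)
  then have "meets_vec U S' - ?c m *\<^sub>R contains_vec S' \<in> ?F"
    using chain_mono[of "vec.dim S'" j] S'(4) by auto
  moreover have "contains_vec S' \<in> ?F" using S'P S'(4) by (intro contains_vec_in) auto
  ultimately have "(meets_vec U S' - ?c m *\<^sub>R contains_vec S') + ?c m *\<^sub>R contains_vec S' \<in> ?F"
    using F subspace_add subspace_scale by blast
  then have mem1: "meets_vec U S' \<in> ?F" by simp
  have "(\<Sum>y\<in>S - S'. meets_vec (?U y) S - ?c m *\<^sub>R contains_vec S) \<in> ?F"
  proof (rule subspace_sum[OF F])
    fix y assume y: "y \<in> S - S'"
    show "meets_vec (?U y) S - ?c m *\<^sub>R contains_vec S \<in> ?F"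
      using Suc.IH[OF S _ UyS[OF y]] dimU[OF y] ju by (simp add: j_def)
  qed
  then have mem2: "(\<Sum>y\<in>S - S'. meets_vec (?U y) S)
      - (real (card (S - S')) * ?c m) *\<^sub>R contains_vec S \<in> ?F"
    by (simp only: sum_subtractf sum_constant_scaleR scaleR_scaleR)
  have "real (card (S - S')) = q ^ j - q ^ (j - 1)"
    using card_subspace_diff_q[OF sS S'(1,3)] S'(4) unfolding j_def[symmetric] by (metis add_diff_cancel_right')
  also have "\<dots> = q ^ m * D"
    using ju by (simp add: D_def power_add algebra_simps)
  finally have "real (card (S - S')) / D = q ^ m" using D by simp
  then have coeff: "- (1 / D) * (real (card (S - S')) * ?c m) = ?c (Suc m)"
    using D by (simp add: numeral_2_eq_2 power_add field_simps)
  have "meets_vec U S' - (1 / D) *\<^sub>R ((\<Sum>y\<in>S - S'. meets_vec (?U y) S)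
      - (real (card (S - S')) * ?c m) *\<^sub>R contains_vec S) \<in> ?F"
    by (intro subspace_diff[OF F mem1] subspace_scale[OF F mem2])
  also have "meets_vec U S' - (1 / D) *\<^sub>R ((\<Sum>y\<in>S - S'. meets_vec (?U y) S)
      - (real (card (S - S')) * ?c m) *\<^sub>R contains_vec S)
    = meets_vec U S - ?c (Suc m) *\<^sub>R contains_vec S"
    unfolding count coeff[symmetric] by (simp add: algebra_simps)
  finally show ?case by (simp add: j_def)
qed

abbreviation "opposite_eigenvalue r \<equiv> opposite_number (d - r) * ((-1) ^ r * q ^ (r choose 2))"

text \<open>A generator over \<open>S\<close> can be opposite to \<open>a\<close> only if \<open>S\<close> itself meets \<open>a\<close> trivially.\<close>

lemma opposite_contains_vec:
  assumes d: "d \<ge> 1" and S: "S \<in> P"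
  shows "generator_op d (contains_vec S) = opposite_number (d - vec.dim S) *\<^sub>R meets_vec {0} S"
proof (subst vec_eq_iff, intro allI)
  fix a
  show "generator_op d (contains_vec S) $ a
    = (opposite_number (d - vec.dim S) *\<^sub>R meets_vec {0} S) $ a"
  proof (cases "a \<in> G")
    case False
    then show ?thesis by (simp add: generator_op_def meets_vec_def)
  next
    case a: True
    have iff: "d - vec.dim (a \<inter> b) = d \<longleftrightarrow> b \<inter> a = {0}" if "b \<in> G" for b
    proof -
      have "vec.dim (b \<inter> a) = 0 \<longleftrightarrow> b \<inter> a = {0}"
        using generatorD(3)[OF a] generatorD(3)[OF that] by (intro subspace_0I) simp
      then show ?thesis using d unfolding Int_commute[of a b] by linarith
    qed
    have "generator_op d (contains_vec S) $ a = (\<Sum>b\<in>G. adj_matrix d d a b * contains_vec S $ b)"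
      using a by (simp add: generator_op_def)
    also have "\<dots> = (\<Sum>b\<in>G. of_bool (S \<subseteq> b \<and> b \<inter> a = {0}))"
      by (intro sum.cong refl) (auto simp: contains_vec_def adj_matrix_def iff)
    also have "\<dots> = real (card {b \<in> G. S \<subseteq> b \<and> b \<inter> a = {0}})"
      by (rule sum_of_bool_eq_card) simp
    finally have lhs: "generator_op d (contains_vec S) $ a = real (card {b \<in> G. S \<subseteq> b \<and> b \<inter> a = {0}})" .
    show ?thesis
    proof (cases "S \<inter> a = {0}")
      case True
      then show ?thesis using lhs card_opposite[OF S a True] a by (simp add: meets_vec_def)
    next
      case False
      have "{b \<in> G. S \<subseteq> b \<and> b \<inter> a = {0}} = {}"
      proof -
        have False if b: "b \<in> G" "S \<subseteq> b" "b \<inter> a = {0}" for b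
        proof -
          have "0 \<in> S \<inter> a" using generatorD(3)[OF a] element_subspace[OF S] by simp
          then show False using b False by blast
        qed
        then show ?thesis by auto
      qed
      then show ?thesis using lhs False by (simp only: card.empty) (simp add: meets_vec_def)
    qed
  qed
qed

lemma adjacency_triangular:
  assumes "d \<ge> 1" "u \<in> filtration (Suc r)"
  shows "generator_op 1 u - adjacency_eigenvalue r *\<^sub>R u \<in> filtration r"
proof (rule triangularI[OF linear_generator_op _ assms(2)])
  fix S assume S: "S \<in> P"
  have "(\<Sum>T\<in>hyperplanes_over {0} S. contains_vec T) \<in> filtration (vec.dim S)"
    using element_down[OF S] chain_subspace
    by (intro subspace_sum contains_vec_in) (auto simp: hyperplanes_over_def)
  then show "generator_op 1 (contains_vec S) - adjacency_eigenvalue (vec.dim S) *\<^sub>R contains_vec S \<in> filtration (vec.dim S)"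
    unfolding adjacency_contains_vec[OF assms(1) S] by simp
qed

lemma opposite_triangular:
  assumes "d \<ge> 1" "u \<in> filtration (Suc r)"
  shows "generator_op d u - opposite_eigenvalue r *\<^sub>R u \<in> filtration r"
proof (rule triangularI[OF linear_generator_op _ assms(2)])
  fix S assume S: "S \<in> P"
  have "meets_vec {0} S - ((-1) ^ vec.dim S * q ^ (vec.dim S choose 2)) *\<^sub>R contains_vec S
      \<in> filtration (vec.dim S)"
    using S element_subspace[OF S] by (intro meets_vec_coefficient) auto
  then have "opposite_number (d - vec.dim S) *\<^sub>R (meets_vec {0} S
      - ((-1) ^ vec.dim S * q ^ (vec.dim S choose 2)) *\<^sub>R contains_vec S) \<in> filtration (vec.dim S)"
    using chain_subspace subspace_scale by blast
  then show "generator_op d (contains_vec S) - opposite_eigenvalue (vec.dim S) *\<^sub>R contains_vec S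
      \<in> filtration (vec.dim S)"
    unfolding opposite_contains_vec[OF assms(1) S] by (simp add: algebra_simps)
qed

end

section \<open>Polar spaces of reflexive forms\<close>

lemma dim_kernel_of_functional:
  fixes g :: "'k::field ^ 'n \<Rightarrow> 'k"
  assumes A: "vec.subspace A"
    and add: "\<And>x y. g (x + y) = g x + g y" and scale: "\<And>c x. g (c *s x) = c * g x"
    and a: "a \<in> A" "g a \<noteq> 0"
  shows "vec.dim A = vec.dim (A \<inter> {x. g x = 0}) + 1"
proof -
  let ?K = "A \<inter> {x. g x = 0}"
  have g0: "g 0 = 0" using scale[of 0 0] by simp
  have K: "vec.subspace ?K"
    using A by (auto simp: vec.subspace_def add scale g0)
  have "A \<subseteq> vec.span (insert a ?K)"
  proof
    fix x assume x: "x \<in> A"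
    let ?c = "- (g x / g a)"
    have "x + ?c *s a \<in> A" using A x a vec.subspace_add vec.subspace_scale by blast
    moreover have "g (x + ?c *s a) = 0" unfolding add scale using a(2) by simp
    ultimately have "x - (g x / g a) *s a \<in> vec.span ?K" by (simp add: vec.span_base)
    then show "x \<in> vec.span (insert a ?K)" unfolding vec.span_breakdown_eq by blast
  qed
  moreover have "vec.span (insert a ?K) \<subseteq> A" using A a by (intro span_insert_subset) auto
  ultimately have "A = vec.span (insert a ?K)" by (rule subset_antisym)
  moreover have "vec.dim (vec.span (insert a ?K)) = Suc (vec.dim ?K)"
    using K a by (intro dim_insert_subspace) auto
  ultimately show ?thesis by simp
qed

text \<open>
  A common frame for the polarization of a quadratic form, with \<open>sing\<close> the singular vectors, and for
  symplectic and Hermitian forms, with \<open>sing\<close> the isotropic vectors. Nondegeneracy is required of singular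
  vectors only, since in characteristic 2 a polarization may have a radical.
\<close>

locale reflexive_form =
  fixes f :: "'k::{field,finite} ^ 'n \<Rightarrow> 'k ^ 'n \<Rightarrow> 'k"
    and sing :: "'k ^ 'n \<Rightarrow> bool"
  assumes f_add: "f (x + y) z = f x z + f y z"
    and f_scale: "f (c *s x) z = c * f x z"
    and f_reflexive: "f x y = 0 \<Longrightarrow> f y x = 0"
    and sing_0: "sing 0"
    and sing_scale: "sing x \<Longrightarrow> sing (c *s x)"
    and sing_add: "sing x \<Longrightarrow> sing y \<Longrightarrow> f x y = 0 \<Longrightarrow> sing (x + y)"
    and sing_isotropic: "sing x \<Longrightarrow> f x x = 0"
    and sing_nondegenerate: "sing x \<Longrightarrow> (\<And>y. f x y = 0) \<Longrightarrow> x = 0"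
begin

definition singular_subspaces :: "('k ^ 'n) set set" where
  "singular_subspaces = {S. vec.subspace S \<and> (\<forall>x\<in>S. sing x) \<and> (\<forall>x\<in>S. \<forall>y\<in>S. f x y = 0)}"

lemma f_sym0: "f x y = 0 \<longleftrightarrow> f y x = 0"
  using f_reflexive by blast

lemma subspace_orth: "vec.subspace {y. f x y = 0}"
  using f_scale[of 0 0 x] unfolding f_sym0[of x]
  by (simp add: vec.subspace_def f_add f_scale)

lemma f_add_right: "f x y = 0 \<Longrightarrow> f x z = 0 \<Longrightarrow> f x (y + z) = 0"
  using vec.subspace_add[OF subspace_orth[of x], of y z] by simp

lemma f_scale_right: "f x y = 0 \<Longrightarrow> f x (c *s y) = 0"
  using vec.subspace_scale[OF subspace_orth[of x], of y c] by simp

lemma singular_subspaces_join: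
  assumes "S \<in> singular_subspaces" "T \<in> singular_subspaces" "\<And>x y. x \<in> S \<Longrightarrow> y \<in> T \<Longrightarrow> f x y = 0"
  shows "vec.span (S \<union> T) \<in> singular_subspaces"
proof -
  have sub: "vec.subspace S" "vec.subspace T" using assms by (auto simp: singular_subspaces_def)
  have span: "\<exists>x\<in>S. \<exists>y\<in>T. v = x + y" if "v \<in> vec.span (S \<union> T)" for v
    using that sub by (auto simp: vec.span_Un vec.span_eq_iff[THEN iffD2])
  have "sing v" if v: "v \<in> vec.span (S \<union> T)" for v
  proof -
    obtain x y where "x \<in> S" "y \<in> T" "v = x + y" using span[OF v] by blast
    then show ?thesis using assms sing_add by (auto simp: singular_subspaces_def)
  qed
  moreover have "f v w = 0" if vw: "v \<in> vec.span (S \<union> T)" "w \<in> vec.span (S \<union> T)" for v w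
  proof -
    obtain x y where v: "x \<in> S" "y \<in> T" "v = x + y" using span[OF vw(1)] by blast
    obtain x' y' where w: "x' \<in> S" "y' \<in> T" "w = x' + y'" using span[OF vw(2)] by blast
    have "f x (x' + y') = 0" "f y (x' + y') = 0"
      using v w assms f_reflexive by (auto simp: singular_subspaces_def intro!: f_add_right)
    then show ?thesis using v w f_add by simp
  qed
  ultimately show ?thesis by (simp add: singular_subspaces_def)
qed

lemma span_singular: "sing x \<Longrightarrow> vec.span {x} \<in> singular_subspaces"
  unfolding singular_subspaces_def
  using sing_scale sing_isotropic f_scale f_scale_right
  by (simp add: vec.subspace_span) (auto simp: vec.span_singleton)

lemma span_insert_singular:
  assumes "S \<in> singular_subspaces" "sing x" "\<And>s. s \<in> S \<Longrightarrow> f s x = 0"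
  shows "vec.span (insert x S) \<in> singular_subspaces"
proof -
  have "vec.span (S \<union> vec.span {x}) \<in> singular_subspaces"
    using assms f_scale_right
    by (intro singular_subspaces_join span_singular) (auto simp: vec.span_singleton)
  moreover have "vec.span (S \<union> vec.span {x}) = vec.span (insert x S)"
  proof (rule subset_antisym)
    have "S \<union> vec.span {x} \<subseteq> vec.span (insert x S)"
      using vec.span_superset[of "insert x S"] vec.span_mono[of "{x}" "insert x S"] by auto
    then show "vec.span (S \<union> vec.span {x}) \<subseteq> vec.span (insert x S)" by (simp add: vec.span_minimal)
    show "vec.span (insert x S) \<subseteq> vec.span (S \<union> vec.span {x})"
      by (rule vec.span_mono) (auto simp: vec.span_base)
  qed
  ultimately show ?thesis by simp
qed

lemma polar_geometry_singular_subspaces: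
  assumes d: "Max (vec.dim ` singular_subspaces) = d"
  shows "polar_geometry singular_subspaces (\<lambda>x y. f x y = 0) d (real CARD('k))"
proof
  fix S T assume S: "S \<in> singular_subspaces"
  then show "vec.subspace S" by (simp add: singular_subspaces_def)
  show "T \<in> singular_subspaces" if "vec.subspace T" "T \<subseteq> S"
    using S that by (auto simp: singular_subspaces_def)
  show "f x y = 0" if "x \<in> S" "y \<in> S" for x y
    using S that by (simp add: singular_subspaces_def)
  show "vec.span (S \<union> T) \<in> singular_subspaces"
    if "T \<in> singular_subspaces" "\<And>x y. x \<in> S \<Longrightarrow> y \<in> T \<Longrightarrow> f x y = 0"
    using singular_subspaces_join[OF S] that by blast
  show "vec.dim S \<le> d" using d S by (metis Max_ge finite finite_imageI imageI)
next
  show "generators d singular_subspaces \<noteq> {}"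
  proof -
    have "{0} \<in> singular_subspaces"
      using sing_0 f_scale[of 0 0 0] by (simp add: singular_subspaces_def)
    then have "d \<in> vec.dim ` singular_subspaces"
      unfolding d[symmetric] by (intro Max_in) auto
    then show ?thesis by (auto simp: generators_def)
  qed
next
  fix A :: "('k ^ 'n) set" and x
  assume A: "vec.subspace A"
  show "vec.dim A \<le> vec.dim (A \<inter> {y. f x y = 0}) + 1"
  proof (cases "A \<subseteq> {y. f x y = 0}")
    case True
    then show ?thesis by (simp add: Int_absorb2)
  next
    case False
    then obtain a where "a \<in> A" "f a x \<noteq> 0" using f_reflexive by blast
    then have "vec.dim A = vec.dim (A \<inter> {y. f y x = 0}) + 1"
      using A by (intro dim_kernel_of_functional) (auto simp: f_add f_scale)
    then show ?thesis unfolding f_sym0[of x] by simp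
  qed
qed (use subspace_orth f_reflexive in auto)

text \<open>
  Pairs \<open>(s, v)\<close> with \<open>s \<in> S\<close> and \<open>f s v = 0\<close> are counted in two ways. No nonzero vector of \<open>S\<close> lies in the
  radical, so every \<open>s \<noteq> 0\<close> is orthogonal to a hyperplane; a vector \<open>v\<close> is orthogonal to all of \<open>S\<close> or
  to a hyperplane of \<open>S\<close>.
\<close>

lemma dim_perp_singular:
  assumes S: "S \<in> singular_subspaces"
  shows "vec.dim (perp_set (\<lambda>x y. f x y = 0) S) + vec.dim S = CARD('n)"
proof -
  let ?perp = "perp_set (\<lambda>x y. f x y = 0) S" and ?q = "real CARD('k)" and ?N = "CARD('n)"
  define j where "j = vec.dim S"
  have q: "?q \<ge> 2" using CARD_field_ge2[where 'k = 'k] by linarith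
  have sub: "vec.subspace S" using S by (simp add: singular_subspaces_def)
  have "?perp = \<Inter> ((\<lambda>s. {y. f s y = 0}) ` S)" by (auto simp: perp_set_def)
  then have subp: "vec.subspace ?perp"
    using subspace_orth vec.subspace_Inter[of "(\<lambda>s. {y. f s y = 0}) ` S"] by auto
  have dimU: "vec.dim (UNIV :: ('k ^ 'n) set) = ?N" by (simp add: vec.dim_UNIV card_cart_basis vec.dimension_def)
  show ?thesis
  proof (cases "j = 0")
    case True
    then have "S = {0}" using subspace_0I[OF sub] by (simp add: j_def)
    then have "?perp = UNIV" using f_scale[of 0 0] by (simp add: perp_set_def)
    then show ?thesis using dimU True by (simp add: j_def)
  next
    case False
    then obtain i where i: "j = Suc i" by (cases j) auto
    have kernel_s: "real (card {v. f s v = 0}) = ?q ^ (?N - 1)" if s: "s \<in> S" "s \<noteq> 0" for s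
    proof -
      have "\<not> (\<forall>y. f s y = 0)" using sing_nondegenerate[of s] s S by (auto simp: singular_subspaces_def)
      then obtain y where "f y s \<noteq> 0" using f_reflexive by blast
      then have "vec.dim (UNIV :: ('k ^ 'n) set) = vec.dim (UNIV \<inter> {v. f v s = 0}) + 1"
        by (intro dim_kernel_of_functional) (auto simp: f_add f_scale)
      then have "vec.dim {v. f s v = 0} = ?N - 1" using dimU unfolding f_sym0[of s] by simp
      then show ?thesis using card_subspace[OF subspace_orth[of s]] by simp
    qed
    have kernel_v: "real (card {s \<in> S. f s v = 0}) = (if v \<in> ?perp then ?q ^ j else ?q ^ i)" for v
    proof (cases "v \<in> ?perp")
      case True
      then have "{s \<in> S. f s v = 0} = S" by (auto simp: perp_set_def)
      then show ?thesis using True card_subspace[OF sub] by (simp add: j_def)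
    next
      case False
      then obtain s where "s \<in> S" "f s v \<noteq> 0" by (auto simp: perp_set_def)
      then have "vec.dim S = vec.dim (S \<inter> {s. f s v = 0}) + 1"
        using sub by (intro dim_kernel_of_functional) (auto simp: f_add f_scale)
      then have dimk: "vec.dim (S \<inter> {s. f s v = 0}) = i" using i by (simp add: j_def)
      have "vec.subspace {s. f s v = 0}" using subspace_orth[of v] unfolding f_sym0[of v] .
      then have "card (S \<inter> {s. f s v = 0}) = CARD('k) ^ i"
        using card_subspace[of "S \<inter> {s. f s v = 0}"] sub dimk by simp
      moreover have "S \<inter> {s. f s v = 0} = {s \<in> S. f s v = 0}" by blast
      ultimately show ?thesis using False by simp
    qed
    have "(\<Sum>v\<in>UNIV. card {s \<in> S. f s v = 0}) = (\<Sum>s\<in>S. card {v \<in> UNIV. f s v = 0})"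
      by (rule sum_multicount_gen) auto
    then have swap: "(\<Sum>v\<in>UNIV. real (card {s \<in> S. f s v = 0})) = (\<Sum>s\<in>S. real (card {v. f s v = 0}))"
      by (simp flip: of_nat_sum)
    have left: "(\<Sum>v\<in>UNIV. real (card {s \<in> S. f s v = 0}))
        = real (card ?perp) * ?q ^ j + real (card (- ?perp)) * ?q ^ i"
      unfolding kernel_v by (simp add: sum.If_cases)
    have right: "(\<Sum>s\<in>S. real (card {v. f s v = 0})) = ?q ^ ?N + (?q ^ j - 1) * ?q ^ (?N - 1)"
    proof -
      have "(\<Sum>s\<in>S. real (card {v. f s v = 0}))
          = real (card {v. f 0 v = 0}) + (\<Sum>s\<in>S - {0}. real (card {v. f s v = 0}))"
        using sub by (intro sum.remove) auto
      also have "{v. f 0 v = 0} = UNIV" using f_scale[of 0 0] by simp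
      also have "(\<Sum>s\<in>S - {0}. real (card {v. f s v = 0})) = real (card (S - {0})) * ?q ^ (?N - 1)"
        using kernel_s by simp
      also have "real (card (S - {0})) = ?q ^ j - 1"
        using card_subspace_diff[OF sub, of "{0}"] sub by (simp add: j_def)
      finally show ?thesis by simp
    qed
    have compl: "real (card (- ?perp)) = ?q ^ ?N - real (card ?perp)"
      using card_subspace_diff[of UNIV ?perp] subp dimU card_subspace[OF subp]
      by (simp add: Compl_eq_Diff_UNIV)
    obtain M where M: "?N = Suc M" 
      using zero_less_card_finite[where ?'a = 'n] by (cases "CARD('n)") auto
    have solve: "z * (u * (t - 1)) = w * (t - 1)"
      if "z * (t * u) + (t * w - z) * u = t * w + (t * u - 1) * w" for z t u w :: real
      using that by (simp add: algebra_simps)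
    have "real (card ?perp) * (?q ^ i * (?q - 1)) = ?q ^ M * (?q - 1)"
      using swap unfolding left right compl i M diff_Suc_1 power_Suc by (rule solve)
    then have "real (card ?perp) * ?q ^ i = ?q ^ M" using q by simp
    then have "?q ^ (vec.dim ?perp + i) = ?q ^ M"
      using card_subspace[OF subp] by (simp add: power_add)
    then have "vec.dim ?perp + i = M" using q by simp
    then show ?thesis using M i by (simp add: j_def)
  qed
qed

text \<open>
  Let \<open>c\<close> be one generator over \<open>T\<close> and \<open>x \<in> c - T\<close>. The other generators over \<open>T\<close> partition, outside \<open>T\<close>,
  the singular vectors of \<open>T\<^sup>\<bottom>\<close> that are not orthogonal to \<open>x\<close>, because a singular vector of \<open>c\<^sup>\<bottom>\<close> lies in the
  maximal element \<open>c\<close>. These vectors are counted along the affine lines in direction \<open>x\<close>, each of which carries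
  \<open>m\<close> of them.
\<close>

lemma card_generators_over:
  assumes d: "Max (vec.dim ` singular_subspaces) = d"
    and m: "\<And>x v. sing x \<Longrightarrow> f x v \<noteq> 0 \<Longrightarrow> card {\<alpha>. sing (v + \<alpha> *s x)} = m"
    and T: "T \<in> singular_subspaces" "vec.dim T + 1 = d"
  shows "real (card {b \<in> generators d singular_subspaces. T \<subseteq> b})
    = real m * real CARD('k) ^ CARD('n) / real CARD('k) ^ (2 * d) + 1"
proof -
  interpret polar_geometry singular_subspaces "\<lambda>x y. f x y = 0" d "real CARD('k)"
    by (rule polar_geometry_singular_subspaces[OF d])
  let ?q = "real CARD('k)"
  obtain a where "a \<in> G" using generator_exists by auto
  then obtain c where c: "c \<in> G" "T \<subseteq> c"
    using proj_generator(1)[OF T(1)] subset_proj(1)[of T a] by blast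
  note sub = element_subspace[OF T(1)] generatorD(3)[OF c(1)]
  have "T \<noteq> c" using T(2) generatorD(2)[OF c(1)] by auto
  then obtain x where x: "x \<in> c" "x \<notin> T" using c(2) by auto
  have cP: "c \<in> singular_subspaces" and dimc: "vec.dim c = d" using generatorD[OF c(1)] by auto
  have sx: "sing x" using cP x by (simp add: singular_subspaces_def)
  have span_c: "vec.span (insert x T) = c"
    using dim_insert_subspace[OF sub(1) x(2)] span_insert_subset[OF sub(2) c(2) x(1)] sub(2) T(2) dimc
    by (intro subspace_eqI_dim) auto
  have in_perp_c: "v \<in> perp c \<longleftrightarrow> f x v = 0" if "v \<in> perp T" for v
  proof
    show "f x v = 0" if "v \<in> perp c" using that x by (simp add: perp_set_def)
    assume "f x v = 0"
    then have "insert x T \<subseteq> {u. f v u = 0}" using \<open>v \<in> perp T\<close> f_reflexive by (auto simp: perp_set_def)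
    then have "vec.span (insert x T) \<subseteq> {u. f v u = 0}" using subspace_orth by (intro vec.span_minimal)
    then show "v \<in> perp c" unfolding span_c using f_reflexive by (auto simp: perp_set_def)
  qed
  define D where "D = perp T - perp c"
  define X where "X = {v \<in> D. sing v}"
  have D_iff: "v \<in> D \<longleftrightarrow> v \<in> perp T \<and> f x v \<noteq> 0" for v using in_perp_c by (auto simp: D_def)
  have xT: "x \<in> perp T" using element_subset_perp[OF cP] perp_antimono[OF c(2)] x by auto
  define M where "M = vec.dim (perp c)"
  have M: "vec.dim (perp c) = M" "CARD('n) = M + d"
    using dim_perp_singular[OF cP] dimc by (simp_all add: M_def)
  have cardD: "real (card D) = ?q * ?q ^ M - ?q ^ M"
  proof -
    have "vec.dim (perp T) = Suc M" using dim_perp_singular[OF T(1)] T(2) M(2) by linarith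
    then show ?thesis
      using card_subspace_diff[OF subspace_perp subspace_perp perp_antimono[OF c(2)]] M(1)
      by (simp add: D_def)
  qed

  have shift: "v + \<alpha> *s x \<in> D" if "v \<in> D" for v \<alpha>
  proof -
    have "v + \<alpha> *s x \<in> perp T"
      using that xT by (auto simp: D_iff intro!: vec.subspace_add vec.subspace_scale subspace_perp)
    moreover have "f x (v + \<alpha> *s x) \<noteq> 0"
    proof
      assume "f x (v + \<alpha> *s x) = 0"
      then have "f x ((v + \<alpha> *s x) + (- \<alpha>) *s x) = 0"
        using f_scale_right[OF sing_isotropic[OF sx]] by (rule f_add_right)
      moreover have cancel: "(v + \<alpha> *s x) + (- \<alpha>) *s x = v" by (simp add: vec_eq_iff)
      ultimately have "f x v = 0" unfolding cancel by blast
      then show False using that by (simp add: D_iff)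
    qed
    ultimately show ?thesis by (simp add: D_iff)
  qed
  have "card {v \<in> D. sing (v + \<alpha> *s x)} = card X" for \<alpha>
  proof -
    have "bij_betw (\<lambda>v. v + \<alpha> *s x) {v \<in> D. sing (v + \<alpha> *s x)} X"
      using shift[of _ \<alpha>] shift[of _ "- \<alpha>"]
      by (intro bij_betwI[where g = "\<lambda>v. v + (- \<alpha>) *s x"]) (auto simp: X_def)
    then show ?thesis by (rule bij_betw_same_card)
  qed
  moreover have "card {\<alpha>. sing (v + \<alpha> *s x)} = m" if "v \<in> D" for v
    using m[OF sx, of v] that by (simp add: D_iff)
  moreover have "(\<Sum>v\<in>D. card {\<alpha> \<in> UNIV. sing (v + \<alpha> *s x)}) = (\<Sum>\<alpha>\<in>UNIV. card {v \<in> D. sing (v + \<alpha> *s x)})"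
    by (rule sum_multicount_gen) auto
  ultimately have "card D * m = CARD('k) * card X" by simp
  then have cardX: "real (card D) * real m = ?q * real (card X)" by (metis of_nat_mult)
  let ?B = "{b \<in> G. T \<subseteq> b} - {c}"
  have "card {b \<in> ?B. v \<in> b} = 1" if v: "v \<in> X" for v
  proof -
    have v': "v \<in> perp T" "f x v \<noteq> 0" "sing v" using v by (auto simp: X_def D_iff)
    have vc: "v \<notin> c"
      using v'(2) element_orth[OF cP x(1)] by blast
    have vT: "v \<notin> T" using vc c(2) by blast
    let ?b = "vec.span (insert v T)"
    have "?b \<in> singular_subspaces"
      using v' by (intro span_insert_singular[OF T(1)]) (auto simp: perp_set_def)
    then have b: "?b \<in> G" using dim_insert_subspace[OF sub(1) vT] T(2) by (simp add: generators_def)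
    have unique: "b' = ?b" if "b' \<in> G" "T \<subseteq> b'" "v \<in> b'" for b'
      using generator_eqI[OF b that(1)] span_insert_subset[OF generatorD(3)[OF that(1)] that(2,3)] by simp
    have "?b \<noteq> c" using vc subset_span_insert(2)[of v T] by blast
    then have "?b \<in> {b \<in> ?B. v \<in> b}"
      using b subset_span_insert(1)[of T v] subset_span_insert(2)[of v T] by simp
    then have "{b \<in> ?B. v \<in> b} = {?b}" using unique by auto
    then show ?thesis by simp
  qed
  moreover have "real (card {v \<in> X. v \<in> b}) = ?q ^ d - ?q ^ (d - 1)" if b: "b \<in> ?B" for b
  proof -
    have b': "b \<in> G" "T \<subseteq> b" "b \<noteq> c" using b by auto
    have "v \<in> X" if v: "v \<in> b" "v \<notin> T" for v
    proof -
      have sv: "sing v" using v generatorD(1)[OF b'(1)] by (simp add: singular_subspaces_def)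
      have vT: "v \<in> perp T"
        using element_orth[OF generatorD(1)[OF b'(1)]] b'(2) v(1) by (auto simp: perp_set_def)
      have "f x v \<noteq> 0"
      proof
        assume "f x v = 0"
        then have "v \<in> perp c" using in_perp_c[OF vT] by simp
        then have "vec.span (insert v c) \<in> singular_subspaces"
          using sv by (intro span_insert_singular[OF cP]) (auto simp: perp_set_def)
        then have "vec.dim (vec.span (insert v c)) \<le> d" by (rule element_dim_le)
        then have "v \<in> c" using dim_insert_subspace[OF sub(2), of v] dimc by fastforce
        then have Tc: "vec.span (insert v T) \<subseteq> c" by (rule span_insert_subset[OF sub(2) c(2)])
        have Tb: "vec.span (insert v T) \<subseteq> b"
          by (rule span_insert_subset[OF generatorD(3)[OF b'(1)] b'(2) v(1)])
        have dimT: "vec.dim (vec.span (insert v T)) = d"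
          using dim_insert_subspace[OF sub(1) v(2)] T(2) by simp
        have "vec.span (insert v T) = c"
          by (rule subspace_eqI_dim[OF vec.subspace_span sub(2) Tc]) (simp only: dimT dimc)
        moreover have "vec.span (insert v T) = b"
          by (rule subspace_eqI_dim[OF vec.subspace_span generatorD(3)[OF b'(1)] Tb])
            (simp only: dimT generatorD(2)[OF b'(1)])
        ultimately have "b = c" by simp
        then show False using b'(3) by simp
      qed
      then show ?thesis using sv vT by (simp add: X_def D_iff)
    qed
    moreover have "v \<notin> T" if "v \<in> X" for v
      using that element_subset_perp[OF cP] c(2) by (auto simp: X_def D_def)
    ultimately have "{v \<in> X. v \<in> b} = b - T" by blast
    moreover have "vec.dim T = d - 1" using T(2) by simp
    ultimately show ?thesis
      using card_subspace_diff[OF generatorD(3)[OF b'(1)] sub(1) b'(2)] generatorD(2)[OF b'(1)] by simp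
  qed
  moreover have "(\<Sum>v\<in>X. card {b \<in> ?B. v \<in> b}) = (\<Sum>b\<in>?B. card {v \<in> X. v \<in> b})"
    by (rule sum_multicount_gen) auto
  then have "(\<Sum>v\<in>X. real (card {b \<in> ?B. v \<in> b})) = (\<Sum>b\<in>?B. real (card {v \<in> X. v \<in> b}))"
    by (simp flip: of_nat_sum)
  ultimately have XB: "real (card X) = real (card ?B) * (?q ^ d - ?q ^ (d - 1))" by simp
  have q: "?q \<ge> 2" by (rule q_ge2)
  have qd: "?q * ?q ^ (d - 1) = ?q ^ d" using T(2) by (simp flip: power_Suc)
  have "?q ^ M * real m * (?q - 1) = real (card D) * real m"
    unfolding cardD by (simp add: algebra_simps)
  also have "\<dots> = real (card ?B) * (?q * ?q ^ d - ?q * ?q ^ (d - 1))"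
    unfolding cardX XB by (simp add: algebra_simps)
  also have "\<dots> = real (card ?B) * ?q ^ d * (?q - 1)"
    unfolding qd by (simp add: algebra_simps)
  finally have "?q ^ M * real m = real (card ?B) * ?q ^ d" using q by simp
  moreover have qd0: "?q ^ d > 0" using q by simp
  ultimately have "real (card ?B) = real m * ?q ^ M / ?q ^ d"
    by (subst nonzero_eq_divide_eq) (simp_all add: mult.commute)
  then have "real (card ?B) = real m * (?q ^ M * ?q ^ d) / (?q ^ d * ?q ^ d)" using qd0 by simp
  then have "real (card ?B) = real m * ?q ^ CARD('n) / ?q ^ (2 * d)"
    unfolding M(2) mult_2 power_add .
  moreover have "card {b \<in> G. T \<subseteq> b} = Suc (card ?B)"
    using c by (intro card.remove) auto
  ultimately show ?thesis by simp
qed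

lemma regular_polar_geometry_singular_subspaces:
  assumes d: "Max (vec.dim ` singular_subspaces) = d"
    and m: "\<And>x v. sing x \<Longrightarrow> f x v \<noteq> 0 \<Longrightarrow> card {\<alpha>. sing (v + \<alpha> *s x)} = m" "m > 0"
  shows "regular_polar_geometry singular_subspaces (\<lambda>x y. f x y = 0) d (real CARD('k))
    (real m * real CARD('k) ^ CARD('n) / real CARD('k) ^ (2 * d))"
proof -
  interpret polar_geometry singular_subspaces "\<lambda>x y. f x y = 0" d "real CARD('k)"
    by (rule polar_geometry_singular_subspaces[OF d])
  show ?thesis
    by unfold_locales (use card_generators_over[OF d m(1)] m(2) q_ge2 in auto)
qed

end

section \<open>The Frobenius map and the trace of a finite field\<close>

lemma power_CARD_minus_1:
  fixes x :: "'k::{field,finite}"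
  assumes "x \<noteq> 0"
  shows "x ^ (CARD('k) - 1) = 1"
proof -
  let ?U = "UNIV - {0 :: 'k}"
  have "bij_betw ((*) x) ?U ?U"
    using assms by (intro bij_betwI[where g = "\<lambda>y. y / x"]) auto
  then have "(\<Prod>y\<in>?U. x * y) = (\<Prod>y\<in>?U. y)"
    by (rule prod.reindex_bij_betw)
  then have "x ^ (CARD('k) - 1) * (\<Prod>y\<in>?U. y) = (\<Prod>y\<in>?U. y)"
    by (simp add: prod.distrib card_Diff_singleton)
  moreover have "(\<Prod>y\<in>?U. y) \<noteq> 0" by simp
  ultimately show ?thesis by simp
qed

lemma power_CARD: "x ^ CARD('k) = x" for x :: "'k::{field,finite}"
proof (cases "x = 0")
  case True
  then show ?thesis by simp
next
  case False
  have "x ^ CARD('k) = x * x ^ (CARD('k) - 1)"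
    using CARD_field_ge2[where 'k = 'k] by (simp flip: power_Suc)
  then show ?thesis using power_CARD_minus_1[OF False] by simp
qed

lemma prime_CHAR_finite_field: "prime CHAR('k::{field,finite})"
  by (rule prime_CHAR_semidom) (rule finite_imp_CHAR_pos, simp)

text \<open>
  Adjoining a new element to an additive subgroup multiplies its order by the characteristic,
  so the order of the field is a power of the characteristic.
\<close>

lemma CARD_power_of_CHAR: "\<exists>n. CARD('k::{field,finite}) = CHAR('k) ^ n"
proof -
  let ?p = "CHAR('k)"
  have p: "prime ?p" by (rule prime_CHAR_finite_field)
  then have p2: "?p \<ge> 2" by (rule prime_ge_2_nat)
  have "\<exists>n. CARD('k) = ?p ^ n"
    if "0 \<in> H" "\<And>x y. x \<in> H \<Longrightarrow> y \<in> H \<Longrightarrow> x + y \<in> H" "card H = ?p ^ m" for H :: "'k set" and m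
    using that
  proof (induction "card (- H)" arbitrary: H m rule: less_induct)
    case less
    note H = less.prems(1,2)
    show ?case
    proof (cases "H = UNIV")
      case True
      then show ?thesis using less.prems(3) by auto
    next
      case False
      then obtain x where x: "x \<notin> H" by auto
      have mult: "of_nat i * h \<in> H" if "h \<in> H" for i h
        by (induction i) (use that H in \<open>auto simp: distrib_right add.commute\<close>)
      let ?H = "(\<lambda>(i, h). of_nat i * x + h) ` ({..<?p} \<times> H)"
      have inj_aux: "i = j"
        if ij: "i < ?p" "j < ?p" "i \<le> j" and hh: "h \<in> H" "h' \<in> H"
          and eq: "of_nat i * x + h = of_nat j * x + h'" for i j h h'
      proof (rule ccontr)
        assume "i \<noteq> j"
        define c where "c = (of_nat (j - i) :: 'k)"
        have "c \<noteq> 0"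
          unfolding c_def of_nat_eq_0_iff_char_dvd using \<open>i \<noteq> j\<close> ij by (auto dest!: dvd_imp_le)
        have "(of_nat (?p - 1) :: 'k) = - 1"
          using p2 by (simp add: of_nat_diff)
        then have "h + of_nat (?p - 1) * h' = h - h'" by simp
        moreover have "h + of_nat (?p - 1) * h' \<in> H" using hh mult H by blast
        ultimately have diff: "h - h' \<in> H" by simp
        have "c * x = h - h'"
          using eq ij by (simp add: c_def of_nat_diff algebra_simps)
        have "CARD('k) - 1 = Suc (CARD('k) - 2)"
          using CARD_field_ge2[where 'k = 'k] by linarith
        then have "c ^ (CARD('k) - 2) * c = c ^ (CARD('k) - 1)" by (simp only: power_Suc2)
        then have "x = c ^ (CARD('k) - 2) * (c * x)"
          using power_CARD_minus_1[OF \<open>c \<noteq> 0\<close>] by (simp flip: mult.assoc)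
        also have "\<dots> = of_nat ((j - i) ^ (CARD('k) - 2)) * (h - h')"
          unfolding \<open>c * x = h - h'\<close> by (simp add: c_def)
        finally have "x \<in> H" using mult[OF diff] by (simp only:)
        then show False using x by simp
      qed
      have inj: "inj_on (\<lambda>(i, h). of_nat i * x + h) ({..<?p} \<times> H)"
      proof (rule inj_onI, clarify)
        fix i j h h'
        assume a: "i < ?p" "j < ?p" "h \<in> H" "h' \<in> H" "of_nat i * x + h = of_nat j * x + h'"
        have "i = j"
        proof (cases "i \<le> j")
          case True
          then show ?thesis using inj_aux[of i j h h'] a by simp
        next
          case False
          then show ?thesis using inj_aux[of j i h' h] a by simp
        qed
        then show "i = j \<and> h = h'" using a by simp
      qed
      then have cardH: "card ?H = ?p ^ Suc m"
        using less.prems(3) by (simp add: card_image card_cartesian_product)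
      have sub: "H \<subseteq> ?H"
      proof
        fix h assume "h \<in> H"
        then show "h \<in> ?H" using p2 by (intro image_eqI[of _ _ "(0, h)"]) auto
      qed
      have "x \<in> ?H" using H p2 by (intro image_eqI[of _ _ "(1, 0)"]) auto
      then have "- ?H \<subset> - H" using sub x by blast
      then have "card (- ?H) < card (- H)" by (intro psubset_card_mono) auto
      moreover have "0 \<in> ?H" using sub H by blast
      moreover have "y + z \<in> ?H" if yz: "y \<in> ?H" "z \<in> ?H" for y z
      proof -
        obtain i h where y: "y = of_nat i * x + h" "h \<in> H" using yz(1) by auto
        obtain j h' where z: "z = of_nat j * x + h'" "h' \<in> H" using yz(2) by auto
        let ?l = "(i + j) mod ?p"
        have "of_nat (i + j) = (of_nat (?p * ((i + j) div ?p) + ?l) :: 'k)" by simp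
        also have "\<dots> = of_nat ?l" unfolding of_nat_add of_nat_mult by simp
        finally have l: "of_nat (i + j) = (of_nat ?l :: 'k)" .
        have "y + z = of_nat (i + j) * x + (h + h')" by (simp add: y z algebra_simps)
        then have "y + z = of_nat ?l * x + (h + h')" unfolding l .
        moreover have "?l < ?p" using p2 by simp
        ultimately show ?thesis using H y z by (intro image_eqI[of _ _ "(?l, h + h')"]) auto
      qed
      ultimately show ?thesis using less.hyps[of ?H "Suc m"] cardH by blast
    qed
  qed
  from this[of "{0}" 0] show ?thesis by simp
qed

text \<open>A square root of the order of the field is a power of the characteristic.\<close>

lemma frobenius_sqrt_add:
  fixes x y :: "'k::{field,finite}"
  assumes "s ^ 2 = CARD('k)"
  shows "(x + y) ^ s = x ^ s + y ^ s"
proof -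
  obtain n where n: "CARD('k) = CHAR('k) ^ n" using CARD_power_of_CHAR by blast
  have p: "prime CHAR('k)" by (rule prime_CHAR_finite_field)
  have "s dvd CHAR('k) ^ n" using assms n by (metis dvd_triv_left power2_eq_square)
  then obtain i where "s = CHAR('k) ^ i" using divides_primepow_nat[OF p] by blast
  then show ?thesis using freshmans_dream'[OF p] by blast
qed

lemma card_roots_power_plus_linear:
  fixes a b :: "'k::{field,finite}"
  assumes "s \<ge> 2"
  shows "card {z. z ^ s + a * z + b = 0} \<le> s"
proof -
  define g where "g = monom 1 s + [:b, a:]"
  have deg: "degree [:b, a:] < degree (monom (1::'k) s)"
    using assms by (simp add: degree_monom_eq)
  then have "degree g = s" unfolding g_def by (simp add: degree_add_eq_left degree_monom_eq)
  moreover from this have "g \<noteq> 0" using assms by auto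
  moreover have "{z. poly g z = 0} = {z. z ^ s + a * z + b = 0}"
    by (simp add: g_def poly_monom algebra_simps)
  ultimately show ?thesis using card_poly_roots_bound[of g] by simp
qed

text \<open>
  The trace maps the \<open>s\<^sup>2\<close> elements of the field into the at most \<open>s\<close> fixed points of \<open>z \<mapsto> z\<^sup>s\<close>, and all
  its fibres have at most \<open>s\<close> elements; so every fibre over a fixed point has exactly \<open>s\<close> elements.
\<close>

lemma card_trace_fibre:
  fixes c :: "'k::{field,finite}"
  assumes s: "s ^ 2 = CARD('k)" and c: "c ^ s = c"
  shows "card {z. z + z ^ s = c} = s"
proof -
  have s2: "s \<ge> 2"
  proof (rule ccontr)
    assume "\<not> s \<ge> 2"
    then have "s = 0 \<or> s = 1" by auto
    then show False using s CARD_field_ge2[where 'k = 'k] by auto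
  qed
  define F where "F = {z :: 'k. z ^ s = z}"
  have cardF: "card F \<le> s"
    using card_roots_power_plus_linear[OF s2, of "-1" "0 :: 'k"] by (simp add: F_def)
  have fibre: "card {z. z + z ^ s = t} \<le> s" for t :: 'k
    using card_roots_power_plus_linear[OF s2, of 1 "- t"] by (simp add: add.commute)
  have inF: "z + z ^ s \<in> F" for z :: 'k
  proof -
    have "(z ^ s) ^ s = z" using power_CARD[of z] unfolding s[symmetric] by (simp add: power2_eq_square power_mult)
    then show ?thesis by (simp add: F_def frobenius_sqrt_add[OF s] add.commute)
  qed
  have "(\<Sum>z\<in>(UNIV :: 'k set). card {t \<in> F. z + z ^ s = t}) = (\<Sum>t\<in>F. card {z \<in> UNIV. z + z ^ s = t})"
    by (rule sum_multicount_gen) auto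
  moreover have "{t \<in> F. z + z ^ s = t} = {z + z ^ s}" for z using inF[of z] by auto
  ultimately have total: "s * s = (\<Sum>t\<in>F. card {z. z + z ^ s = t})"
    using s by (simp add: power2_eq_square)
  show ?thesis
  proof (rule ccontr)
    assume "card {z. z + z ^ s = c} \<noteq> s"
    then have "card {z. z + z ^ s = c} < s" using fibre[of c] by simp
    moreover have "c \<in> F" using c by (simp add: F_def)
    ultimately have "(\<Sum>t\<in>F. card {z. z + z ^ s = t}) < (\<Sum>t\<in>F. s)"
      using fibre by (intro sum_strict_mono_ex1) auto
    also have "\<dots> \<le> s * s" using cardF by simp
    finally show False using total by simp
  qed
qed

section \<open>The classical forms\<close>

lemma linear_functional_add:
  "Vector_Spaces.linear (*s) (*) g \<Longrightarrow> g (x + y) = g x + g y"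
  and linear_functional_scale: "Vector_Spaces.linear (*s) (*) g \<Longrightarrow> g (c *s x) = c * g x"
  for g :: "'k::field ^ 'n \<Rightarrow> 'k"
  by (simp_all add: Vector_Spaces.linear_def module_hom_def module_hom_axioms_def)

context
  fixes Q :: "'k::{field,finite} ^ 'n \<Rightarrow> 'k"
  assumes quadratic: "quadratic_form Q"
begin

lemma quadratic_scale: "Q (c *s x) = c ^ 2 * Q x"
  using quadratic by (simp add: quadratic_form_def)

lemma polarization_linear:
  "Vector_Spaces.linear (*s) (*) (\<lambda>x. polarization Q x y)"
  "Vector_Spaces.linear (*s) (*) (\<lambda>y. polarization Q x y)"
  using quadratic by (simp_all add: quadratic_form_def bilinear_form_def)

lemma polarization_commute: "polarization Q x y = polarization Q y x"
  by (simp add: polarization_def add.commute)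

lemma reflexive_form_polarization:
  assumes "nondegenerate_quadratic Q"
  shows "reflexive_form (polarization Q) (\<lambda>x. Q x = 0)"
proof
  show "polarization Q (x + y) z = polarization Q x z + polarization Q y z" for x y z
    by (rule linear_functional_add[OF polarization_linear(1)])
  show "polarization Q (c *s x) z = c * polarization Q x z" for c x z
    by (rule linear_functional_scale[OF polarization_linear(1)])
  show "polarization Q y x = 0" if "polarization Q x y = 0" for x y
    using that by (simp add: polarization_commute)
  show "Q 0 = 0" using quadratic_scale[of 0 0] by simp
  show "Q (c *s x) = 0" if "Q x = 0" for c x using that by (simp add: quadratic_scale)
  show "Q (x + y) = 0" if "Q x = 0" "Q y = 0" "polarization Q x y = 0" for x y
    using that by (simp add: polarization_def)
  show "polarization Q x x = 0" if "Q x = 0" for x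
  proof -
    have "x + x = 2 *s x" by (simp add: vec_eq_iff)
    then show ?thesis using that quadratic_scale[of 2 x] by (simp add: polarization_def)
  qed
  show "x = 0" if "Q x = 0" "\<And>y. polarization Q x y = 0" for x
    using that assms by (auto simp: nondegenerate_quadratic_def)
qed

text \<open>On a line in a singular direction \<open>x\<close> a quadratic form is affine, with slope \<open>polarization Q v x\<close>.\<close>

lemma card_singular_on_line_quadratic:
  assumes "Q x = 0" "polarization Q x v \<noteq> 0"
  shows "card {\<alpha>. Q (v + \<alpha> *s x) = 0} = 1"
proof -
  have "Q (v + \<alpha> *s x) = Q v + \<alpha> * polarization Q v x" for \<alpha>
  proof -
    have "polarization Q v (\<alpha> *s x) = \<alpha> * polarization Q v x"
      by (rule linear_functional_scale[OF polarization_linear(2)])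
    then show ?thesis using assms(1) quadratic_scale[of \<alpha> x] by (simp add: polarization_def[of Q v "\<alpha> *s x"] algebra_simps)
  qed
  moreover have b: "polarization Q v x \<noteq> 0" using assms(2) by (simp add: polarization_commute)
  then have "Q v + \<alpha> * polarization Q v x = 0 \<longleftrightarrow> \<alpha> = - Q v / polarization Q v x" for \<alpha>
  proof -
    have "Q v + \<alpha> * polarization Q v x = 0 \<longleftrightarrow> \<alpha> * polarization Q v x = - Q v"
      by (simp only: eq_neg_iff_add_eq_0 add.commute)
    also have "\<dots> \<longleftrightarrow> \<alpha> = - Q v / polarization Q v x"
      by (rule nonzero_eq_divide_eq[OF b, symmetric])
    finally show ?thesis .
  qed
  ultimately show ?thesis by simp
qed

lemma totally_singular_eq:
  "totally_singular Q = reflexive_form.singular_subspaces (polarization Q) (\<lambda>x. Q x = 0)"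
  if "nondegenerate_quadratic Q"
proof -
  interpret reflexive_form "polarization Q" "\<lambda>x. Q x = 0" by (rule reflexive_form_polarization[OF that])
  show ?thesis
    unfolding totally_singular_def singular_subspaces_def
    by (auto simp: polarization_def vec.subspace_add)
qed

end

lemma reflexive_form_symplectic:
  fixes f :: "'k::{field,finite} ^ 'n \<Rightarrow> 'k ^ 'n \<Rightarrow> 'k"
  assumes "symplectic_form f" "nondegenerate_form f"
  shows "reflexive_form f (\<lambda>_. True)"
proof
  have lin: "Vector_Spaces.linear (*s) (*) (\<lambda>x. f x y)" "Vector_Spaces.linear (*s) (*) (\<lambda>y. f x y)" for x y
    using assms(1) by (simp_all add: symplectic_form_def bilinear_form_def)
  show add: "f (x + y) z = f x z + f y z" for x y z
    by (rule linear_functional_add[OF lin(1)])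
  show "f (c *s x) z = c * f x z" for c x z
    by (rule linear_functional_scale[OF lin(1)])
  show alt: "f x x = 0" for x using assms(1) by (simp add: symplectic_form_def)
  show "f y x = 0" if "f x y = 0" for x y
    using alt[of "x + y"] add[of x y "x + y"] linear_functional_add[OF lin(2), of x x y]
      linear_functional_add[OF lin(2), of y x y] alt that by simp
  show "x = 0" if "\<And>y. f x y = 0" for x
    using that assms(2) by (simp add: nondegenerate_form_def)
qed auto

context
  fixes f :: "'k::{field,finite} ^ 'n \<Rightarrow> 'k ^ 'n \<Rightarrow> 'k" and s :: nat
  assumes s: "s ^ 2 = CARD('k)"
    and lin: "\<And>y. Vector_Spaces.linear (*s) (*) (\<lambda>x. f x y)"
    and conj: "\<And>x y. f y x = f x y ^ s"
begin

lemma hermitian_zero: "f x y = 0 \<Longrightarrow> f y x = 0"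
proof -
  have "s \<noteq> 0" using s by (intro notI) simp
  then show "f x y = 0 \<Longrightarrow> f y x = 0" using conj[of y x] by (simp add: power_0_left)
qed

lemma reflexive_form_hermitian:
  assumes "nondegenerate_form f"
  shows "reflexive_form f (\<lambda>x. f x x = 0)"
proof
  show add: "f (x + y) z = f x z + f y z" for x y z by (rule linear_functional_add[OF lin])
  show scale: "f (c *s x) z = c * f x z" for c x z by (rule linear_functional_scale[OF lin])
  show "f y x = 0" if "f x y = 0" for x y using that by (rule hermitian_zero)
  show "f 0 0 = 0" using scale[of 0 0 0] by simp
  show "f (c *s x) (c *s x) = 0" if "f x x = 0" for c x
  proof -
    have "f (c *s x) x = 0" using scale that by simp
    then have "f x (c *s x) = 0" by (rule hermitian_zero)
    then show ?thesis using scale by simp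
  qed
  show "f (x + y) (x + y) = 0" if "f x x = 0" "f y y = 0" "f x y = 0" for x y
  proof -
    have "f (x + y) x = 0" "f (x + y) y = 0" using that hermitian_zero[of x y] by (simp_all add: add)
    then have "f x (x + y) = 0" "f y (x + y) = 0" by (auto intro: hermitian_zero)
    then show ?thesis by (simp add: add)
  qed
  show "x = 0" if "\<And>y. f x y = 0" for x
    using that assms by (simp add: nondegenerate_form_def)
qed

text \<open>
  On a line in an isotropic direction the form is the constant \<open>f v v\<close> plus the trace of \<open>\<alpha> (f x v)\<close>; the
  constant is fixed by the field involution, so it is minus a trace in \<open>s\<close> ways.
\<close>

lemma card_singular_on_line_hermitian:
  assumes x: "f x x = 0" and v: "f x v \<noteq> 0"
  shows "card {\<alpha>. f (v + \<alpha> *s x) (v + \<alpha> *s x) = 0} = s"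
proof -
  note add = linear_functional_add[OF lin] and scale = linear_functional_scale[OF lin]
  have expand: "f (v + \<alpha> *s x) (v + \<alpha> *s x) = f v v + (\<alpha> * f x v + (\<alpha> * f x v) ^ s)" for \<alpha>
  proof -
    let ?w = "v + \<alpha> *s x"
    have "f v ?w = (f ?w v) ^ s" by (rule conj)
    also have "\<dots> = f v v ^ s + (\<alpha> * f x v) ^ s"
      unfolding add scale by (rule frobenius_sqrt_add[OF s])
    also have "f v v ^ s = f v v" using conj[of v v] by simp
    finally have "f v ?w = f v v + (\<alpha> * f x v) ^ s" .
    moreover have "f x ?w = (f ?w x) ^ s" by (rule conj)
    then have "f x ?w = f x v" unfolding add scale x using conj[of x v] by simp
    ultimately show ?thesis by (simp add: add scale)
  qed
  have "f v v ^ s + (- f v v) ^ s = (f v v + (- f v v)) ^ s"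
    by (rule frobenius_sqrt_add[OF s, symmetric])
  moreover have "s \<noteq> 0" using s by (intro notI) simp
  ultimately have "(- f v v) ^ s = - f v v"
    using conj[of v v] by (simp add: power_0_left eq_neg_iff_add_eq_0 add.commute)
  then have "card {z. z + z ^ s = - f v v} = s" by (rule card_trace_fibre[OF s])
  moreover have "bij_betw (\<lambda>\<alpha>. \<alpha> * f x v) {\<alpha>. f (v + \<alpha> *s x) (v + \<alpha> *s x) = 0} {z. z + z ^ s = - f v v}"
    using v unfolding expand
    by (intro bij_betwI[where g = "\<lambda>z. z / f x v"]) (auto simp: eq_neg_iff_add_eq_0 add.commute)
  then have "card {\<alpha>. f (v + \<alpha> *s x) (v + \<alpha> *s x) = 0} = card {z. z + z ^ s = - f v v}"
    by (rule bij_betw_same_card)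
  ultimately show ?thesis by simp
qed

end

text \<open>
  Every singular \<open>(d - 1)\<close>-space lies on \<open>m q\<^sup>N\<^sup>-\<^sup>2\<^sup>d + 1\<close> generators, with \<open>N\<close> the ambient dimension and
  \<open>m = 1, q, sqrt q\<close> singular vectors on an affine line for quadratic, symplectic and Hermitian forms. In all
  cases this is \<open>q\<^sup>e + 1\<close>.
\<close>

theorem classical_polar_space_regular:
  fixes P :: "('k::{field,finite} ^ 'n) set set"
  assumes P: "classical_polar_space K d P"
  shows "\<exists>orth. regular_polar_geometry P orth d (real CARD('k)) (real CARD('k) powr polar_type K)"
proof -
  let ?q = "real CARD('k)"
  have q: "?q > 1" using CARD_field_ge2[where 'k = 'k] by linarith
  have dims: "CARD('n) = ambient_dim K d" and Max: "Max (vec.dim ` P) = d"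
    and form: "arises_from_form K P"
    using P by (auto simp: classical_polar_space_def)
  have parameter: "real m * ?q ^ CARD('n) / ?q ^ (2 * d) = ?q powr polar_type K"
    if "real m * ?q ^ ambient_dim K d = ?q powr polar_type K * ?q ^ (2 * d)" for m
    using that q dims by simp
  consider "K \<in> {Hyperbolic, Parabolic, Elliptic}" | "K = Symplectic" | "K \<in> {Hermitian_Odd, Hermitian_Even}"
    by (cases K) auto
  then show ?thesis
  proof cases
    case 1
    then obtain Q where Q: "quadratic_form Q" "nondegenerate_quadratic Q" "P = totally_singular Q"
      using form by (auto simp: arises_from_form_def)
    interpret reflexive_form "polarization Q" "\<lambda>x. Q x = 0"
      by (rule reflexive_form_polarization[OF Q(1,2)])
    have PS: "P = singular_subspaces" using totally_singular_eq[OF Q(1,2)] Q(3) by simp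
    have "real 1 * ?q ^ ambient_dim K d = ?q powr polar_type K * ?q ^ (2 * d)"
      using 1 q by (auto simp: powr_numeral power2_eq_square)
    from parameter[OF this] show ?thesis
      using regular_polar_geometry_singular_subspaces[OF Max[unfolded PS] card_singular_on_line_quadratic[OF Q(1)]]
      unfolding PS by auto
  next
    case 2
    then obtain f where f: "symplectic_form f" "nondegenerate_form f" "P = totally_isotropic f"
      using form by (auto simp: arises_from_form_def)
    interpret reflexive_form f "\<lambda>_. True" by (rule reflexive_form_symplectic[OF f(1,2)])
    have PS: "P = singular_subspaces" using f(3) by (simp add: totally_isotropic_def singular_subspaces_def)
    have "real CARD('k) * ?q ^ ambient_dim K d = ?q powr polar_type K * ?q ^ (2 * d)"
      using 2 q by simp
    from parameter[OF this] show ?thesis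
      using regular_polar_geometry_singular_subspaces[OF Max[unfolded PS], of "CARD('k)"]
      unfolding PS by auto
  next
    case 3
    then obtain f where f': "hermitian_form f" "nondegenerate_form f" "P = totally_isotropic f"
      using form by (auto simp: arises_from_form_def)
    from f'(1) obtain s where f: "s ^ 2 = CARD('k)" "\<And>y. Vector_Spaces.linear (*s) (*) (\<lambda>x. f x y)"
        "\<And>x y. f y x = f x y ^ s"
      unfolding hermitian_form_def by blast
    interpret reflexive_form f "\<lambda>x. f x x = 0" by (rule reflexive_form_hermitian[OF f f'(2)])
    have PS: "P = singular_subspaces" using f'(3) by (auto simp: totally_isotropic_def singular_subspaces_def)
    have s0: "s > 0" using f(1) by (intro Nat.gr0I) simp
    have qs: "?q = real s ^ 2" unfolding f(1)[symmetric] by simp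
    have half: "?q powr (1 / 2) = real s" using s0 unfolding qs by (simp add: powr_half_sqrt)
    have "?q powr (3 / 2) = ?q powr (1 + 1 / 2)" by simp
    also have "\<dots> = ?q * real s" unfolding powr_add half using q by simp
    finally have three_halves: "?q powr (3 / 2) = ?q * real s" .
    have "real s * ?q ^ ambient_dim K d = ?q powr polar_type K * ?q ^ (2 * d)"
      using 3 half three_halves by auto
    from parameter[OF this] show ?thesis
      using regular_polar_geometry_singular_subspaces[OF Max[unfolded PS] card_singular_on_line_hermitian[OF f] s0]
      unfolding PS by metis
  qed
qed

section \<open>Cross-intersecting sets of generators\<close>

lemma choose_two_add: "(m + t) choose 2 = (m choose 2) + (t choose 2) + m * t"
  by (induction t) (simp_all add: numeral_2_eq_2)

context regular_polar_geometry
begin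

definition indicator_vec :: "('k ^ 'n) set set \<Rightarrow> real ^ (('k ^ 'n) set)" where
  "indicator_vec Y = (\<chi> a. indicator Y a)"

lemma inner_indicator_vec: "indicator_vec Y \<bullet> v = (\<Sum>a\<in>Y. v $ a)"
proof -
  have "indicator_vec Y \<bullet> v = (\<Sum>a\<in>UNIV. if a \<in> Y then v $ a else 0)"
    unfolding inner_vec_def by (intro sum.cong refl) (simp add: indicator_vec_def)
  also have "\<dots> = (\<Sum>a\<in>Y. v $ a)" by (simp add: sum.If_cases)
  finally show ?thesis .
qed

lemma filtration_supported:
  assumes "u \<in> filtration r" "a \<notin> G"
  shows "u $ a = 0"
proof -
  have "subspace {u :: real ^ (('k ^ 'n) set). u $ a = 0}" by (simp add: subspace_def)
  moreover have "contains_vec ` {S \<in> P. vec.dim S < r} \<subseteq> {u. u $ a = 0}"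
    using assms(2) by (auto simp: contains_vec_def)
  ultimately have "filtration r \<subseteq> {u. u $ a = 0}" unfolding filtration_def by (rule span_minimal[rotated])
  then show ?thesis using assms(1) by auto
qed

lemma filtration_1: "filtration 1 = span {indicator_vec G}"
proof -
  have "{S \<in> P. vec.dim S < 1} = {{0}}"
    using zero_element element_subspace subspace_0I by auto
  moreover have "contains_vec {0} = indicator_vec G"
    using generatorD(3) by (auto simp: contains_vec_def indicator_vec_def vec_eq_iff indicator_def)
  ultimately show ?thesis by (simp add: filtration_def)
qed

lemma layer_in_eigenspace:
  assumes d: "d \<ge> 1" and Qe: "Qe = q powr polar_type K"
    and u: "u \<in> layer filtration r" and r: "r \<le> d"
  shows "($) u \<in> eigenspace K d P r"
proof -
  have ev: "generator_op 1 u = adjacency_eigenvalue r *\<^sub>R u"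
    by (rule triangular_selfadjoint_eigen[OF linear_generator_op generator_op_selfadjoint _ u r])
      (rule adjacency_triangular[OF d])
  have "(\<Sum>b\<in>G. adj_matrix d 1 a b * u $ b) = eigenvalue (real CARD('k)) (polar_type K) d r * u $ a"
    if "a \<in> G" for a
  proof -
    have "(\<Sum>b\<in>G. adj_matrix d 1 a b * u $ b) = generator_op 1 u $ a"
      using that by (simp add: generator_op_def)
    also have "\<dots> = adjacency_eigenvalue r * u $ a" unfolding ev by simp
    also have "adjacency_eigenvalue r = eigenvalue (real CARD('k)) (polar_type K) d r"
      unfolding eigenvalue_def q_card[symmetric] Qe ..
    finally show ?thesis .
  qed
  moreover have "u $ a = 0" if "a \<notin> G" for a
    using filtration_supported[OF _ that] u by (auto simp: layer_def)
  ultimately show ?thesis by (simp add: eigenspace_def)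
qed

lemma cross_intersecting_bound:
  assumes cross: "cross_intersecting_EKR d P Y Z" and d: "d \<ge> 1" and Qe: "Qe = q powr polar_type K"
    and \<mu>: "\<mu> > 0" "\<And>r. 1 \<le> r \<Longrightarrow> r \<le> d \<Longrightarrow> \<bar>opposite_eigenvalue r\<bar> \<le> \<mu>"
    and R: "R \<subseteq> {..d}" "0 \<in> R" "\<And>r. r \<le> d \<Longrightarrow> r \<notin> R \<Longrightarrow> \<bar>opposite_eigenvalue r\<bar> < \<mu>"
  shows "sqrt (real (card Y) * real (card Z)) \<le> real (card G) * \<mu> / (opposite_number d + \<mu>)"
    and "sqrt (real (card Y) * real (card Z)) = real (card G) * \<mu> / (opposite_number d + \<mu>) \<Longrightarrow>
      indicator Y \<in> eigenspace_sum K d P R \<and> indicator Z \<in> eigenspace_sum K d P R"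
proof -
  have YZ: "Y \<subseteq> G" "Z \<subseteq> G" "\<And>y z. y \<in> Y \<Longrightarrow> z \<in> Z \<Longrightarrow> vec.dim (y \<inter> z) \<ge> 1"
    using cross by (auto simp: cross_intersecting_EKR_def)
  have mem: "indicator_vec S \<in> filtration (Suc d)" if "S \<subseteq> G" for S
    using that by (intro supported_in_filtration) (auto simp: indicator_vec_def indicator_def)
  have self: "indicator_vec S \<bullet> indicator_vec S = real (card S)" for S
    by (simp add: inner_indicator_vec) (simp add: indicator_vec_def)
  have all: "indicator_vec S \<bullet> indicator_vec G = real (card S)" if "S \<subseteq> G" for S
  proof -
    have "indicator_vec S \<bullet> indicator_vec G = (\<Sum>a\<in>S. 1)"
      unfolding inner_indicator_vec using that by (intro sum.cong refl) (auto simp: indicator_vec_def)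
    then show ?thesis by simp
  qed
  have n: "real (card G) > 0" using generator_exists by (simp add: card_gt_0_iff)
  have disjoint: "indicator_vec Y \<bullet> generator_op d (indicator_vec Z) = 0"
  proof -
    have "generator_op d (indicator_vec Z) $ a = 0" if a: "a \<in> Y" for a
    proof -
      have zero: "adj_matrix d d a b * indicator_vec Z $ b = 0" for b
        using YZ(3)[OF a, of b] d by (auto simp: adj_matrix_def indicator_vec_def indicator_def)
      show ?thesis
        by (simp only: generator_op_def vec_lambda_beta zero sum.neutral_const if_cancel)
    qed
    then show ?thesis unfolding inner_indicator_vec by simp
  qed
  have k: "opposite_eigenvalue 0 = opposite_number d" "opposite_number d \<ge> 0"
    using q_ge2 Qe_pos by (simp_all add: opposite_number_def numeral_2_eq_2)
  note hoffman = cross_hoffman_bound[where A = "generator_op d" and c = opposite_eigenvalue and d = d,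
      OF linear_generator_op generator_op_selfadjoint opposite_triangular[OF d]
      filtration_1 self n mem[OF YZ(1)] self all[OF YZ(1)] mem[OF YZ(2)] self all[OF YZ(2)]
      disjoint k \<mu>]
  show "sqrt (real (card Y) * real (card Z)) \<le> real (card G) * \<mu> / (opposite_number d + \<mu>)"
    by (rule hoffman(1))
  assume tight: "sqrt (real (card Y) * real (card Z)) = real (card G) * \<mu> / (opposite_number d + \<mu>)"
  have "\<exists>v w. (\<forall>r\<le>d. v r \<in> layer filtration r \<and> w r \<in> layer filtration r)
      \<and> indicator_vec Y = (\<Sum>r\<le>d. v r) \<and> indicator_vec Z = (\<Sum>r\<le>d. w r)
      \<and> (\<forall>r. 1 \<le> r \<and> r \<le> d \<and> \<bar>opposite_eigenvalue r\<bar> < \<mu> \<longrightarrow> v r = 0 \<and> w r = 0)"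
    by (rule hoffman(2)) (assumption | rule tight)+
  then obtain v w where
    vw: "\<forall>r\<le>d. v r \<in> layer filtration r \<and> w r \<in> layer filtration r"
    and sums: "indicator_vec Y = (\<Sum>r\<le>d. v r)" "indicator_vec Z = (\<Sum>r\<le>d. w r)"
    and zero: "\<forall>r. 1 \<le> r \<and> r \<le> d \<and> \<bar>opposite_eigenvalue r\<bar> < \<mu> \<longrightarrow> v r = 0 \<and> w r = 0"
    by (elim exE conjE)
  have "indicator S \<in> eigenspace_sum K d P R"
    if S: "indicator_vec S = (\<Sum>r\<le>d. u r)" and u: "\<And>r. r \<le> d \<Longrightarrow> u r \<in> layer filtration r"
      and u0: "\<And>r. r \<le> d \<Longrightarrow> r \<notin> R \<Longrightarrow> u r = 0" for S u
  proof -
    have "indicator S a = (\<Sum>r\<in>R. u r $ a)" for a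
    proof -
      have "indicator S a = (\<Sum>r\<le>d. u r) $ a" unfolding S[symmetric] by (simp add: indicator_vec_def)
      also have "\<dots> = (\<Sum>r\<le>d. u r $ a)" by simp
      also have "\<dots> = (\<Sum>r\<in>R. u r $ a)"
        using R(1) u0 by (intro sum.mono_neutral_right) auto
      finally show ?thesis .
    qed
    moreover have "\<forall>r\<in>R. ($) (u r) \<in> eigenspace K d P r"
      using layer_in_eigenspace[OF d Qe u] R(1) by auto
    ultimately show ?thesis
      unfolding eigenspace_sum_def by (intro CollectI exI[of _ "\<lambda>r. ($) (u r)"]) auto
  qed
  note in_sum = this
  have vanish: "v r = 0 \<and> w r = 0" if "r \<le> d" "r \<notin> R" for r
  proof -
    have "r \<noteq> 0" by (rule notI) (use that(2) R(2) in simp)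
    then show ?thesis using zero R(3)[OF that] that(1) by (simp add: Suc_le_eq)
  qed
  show "indicator Y \<in> eigenspace_sum K d P R \<and> indicator Z \<in> eigenspace_sum K d P R"
    using in_sum[OF sums(1)] in_sum[OF sums(2)] vw vanish by simp
qed

lemma abs_opposite_eigenvalue:
  "\<bar>opposite_eigenvalue r\<bar> = q ^ ((d - r) choose 2) * Qe ^ (d - r) * q ^ (r choose 2)"
  using q_ge2 Qe_pos by (simp add: opposite_number_def abs_mult power_abs)

text \<open>
  The exponents \<open>f r\<close> of the eigenvalues satisfy \<open>f 1 - f r = (r - 1) (d - r + e - 1)\<close>, a product form of their convexity that makes
  the comparison with the first eigenvalue a comparison of \<open>q\<^sup>d\<^sup>-\<^sup>r Qe / q\<close> with \<open>1\<close>.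
\<close>

lemma opposite_eigenvalue_ratio:
  assumes "1 \<le> r" "r \<le> d"
  shows "\<bar>opposite_eigenvalue r\<bar> * (q ^ (d - r) * Qe / q) ^ (r - 1) = opposite_number (d - 1)"
proof -
  obtain t where t: "r = Suc t" using assms by (cases r) auto
  obtain m where m: "d = m + Suc t" using assms t by (metis le_add_diff_inverse2)
  have "q ^ (Suc t choose 2) = q ^ (t choose 2) * q ^ t"
    by (simp add: numeral_2_eq_2 power_add)
  moreover have "(q ^ m * Qe / q) ^ t = q ^ (m * t) * Qe ^ t / q ^ t"
    by (simp add: power_divide power_mult_distrib power_mult)
  ultimately have "\<bar>opposite_eigenvalue r\<bar> * (q ^ (d - r) * Qe / q) ^ (r - 1)
      = q ^ (m choose 2) * Qe ^ m * (q ^ (t choose 2) * q ^ t) * (q ^ (m * t) * Qe ^ t / q ^ t)"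
    unfolding abs_opposite_eigenvalue unfolding t m by simp
  also have "\<dots> = q ^ ((m + t) choose 2) * Qe ^ (m + t)"
    using q_ge2 by (simp add: choose_two_add power_add)
  finally show ?thesis by (simp add: opposite_number_def m)
qed

lemma opposite_eigenvalue_first: "opposite_number (d - 1) > 0"
  using q_ge2 Qe_pos by (simp add: opposite_number_def)

text \<open>For \<open>e = 0\<close> the exponents \<open>f r\<close> of the eigenvalues satisfy \<open>f 0 - f r = r (d - r)\<close>, which vanishes only at both ends.\<close>

lemma hyperbolic_eigenvalue_less:
  assumes "Qe = 1" "1 \<le> r" "r < d"
  shows "\<bar>opposite_eigenvalue r\<bar> < opposite_number d"
proof -
  have "(d choose 2) = ((d - r) choose 2) + (r choose 2) + (d - r) * r"
    using choose_two_add[of "d - r" r] assms by simp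
  then have "((d - r) choose 2) + (r choose 2) < (d choose 2)" using assms by simp
  then have "q ^ (((d - r) choose 2) + (r choose 2)) < q ^ (d choose 2)"
    using q_ge2 by (intro power_strict_increasing) auto
  moreover have "opposite_number d = q ^ (d choose 2)"
    unfolding opposite_number_def by (simp add: assms(1))
  ultimately show ?thesis
    unfolding abs_opposite_eigenvalue by (simp only: assms(1) power_add power_one mult_1_right)
qed

lemma opposite_eigenvalue_le:
  assumes "Qe \<ge> q" "1 \<le> r" "r \<le> d"
  shows "\<bar>opposite_eigenvalue r\<bar> \<le> opposite_number (d - 1)"
    and "r \<noteq> 1 \<Longrightarrow> r \<noteq> d \<or> Qe > q \<Longrightarrow> \<bar>opposite_eigenvalue r\<bar> < opposite_number (d - 1)"
proof -
  define \<beta> where "\<beta> = q ^ (d - r) * Qe / q"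
  have pos: "\<bar>opposite_eigenvalue r\<bar> > 0"
    unfolding abs_opposite_eigenvalue using q_ge2 Qe_pos by simp
  have ratio: "\<bar>opposite_eigenvalue r\<bar> * \<beta> ^ (r - 1) = opposite_number (d - 1)"
    unfolding \<beta>_def by (rule opposite_eigenvalue_ratio[OF assms(2,3)])
  have pow: "q ^ (d - r) \<ge> 1" using q_ge2 by (intro one_le_power) simp
  have Qq: "Qe / q \<ge> 1" using assms(1) q_ge2 by simp
  have \<beta>_eq: "\<beta> = q ^ (d - r) * (Qe / q)" by (simp add: \<beta>_def)
  have "1 * 1 \<le> q ^ (d - r) * (Qe / q)" using pow Qq by (intro mult_mono) auto
  then have \<beta>: "\<beta> \<ge> 1" by (simp add: \<beta>_eq)
  then have "\<beta> ^ (r - 1) \<ge> 1" by (rule one_le_power)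
  then have "\<bar>opposite_eigenvalue r\<bar> * 1 \<le> \<bar>opposite_eigenvalue r\<bar> * \<beta> ^ (r - 1)"
    using pos by (intro mult_left_mono) auto
  then show "\<bar>opposite_eigenvalue r\<bar> \<le> opposite_number (d - 1)" using ratio by linarith
  assume r: "r \<noteq> 1" "r \<noteq> d \<or> Qe > q"
  have "\<beta> > 1"
  proof (cases "r = d")
    case True
    then show ?thesis using r q_ge2 by (simp add: \<beta>_def)
  next
    case False
    then have "q ^ (d - r) > 1" using assms q_ge2 by (intro one_less_power) auto
    then have "1 < q ^ (d - r) * (Qe / q)" using Qq by (rule less_1_mult')
    then show ?thesis by (simp add: \<beta>_eq)
  qed
  then have "\<beta> ^ (r - 1) > 1" using r assms by (intro one_less_power) auto
  then have "\<bar>opposite_eigenvalue r\<bar> * 1 < \<bar>opposite_eigenvalue r\<bar> * \<beta> ^ (r - 1)"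
    using pos by (intro mult_strict_left_mono) auto
  then show "\<bar>opposite_eigenvalue r\<bar> < opposite_number (d - 1)" using ratio by linarith
qed

text \<open>
  The ratio of the valency to the absolute value of the first eigenvalue is \<open>q\<^sup>d\<^sup>-\<^sup>1 Qe\<close>, which is also the ratio of the numbers of
  generators off and on a point.
\<close>

lemma hoffman_value_point:
  assumes p: "p \<in> P" "vec.dim p = 1"
  shows "real (card G) * opposite_number (d - 1) / (opposite_number d + opposite_number (d - 1))
    = real (card {g \<in> G. p \<subseteq> g})"
proof -
  have "d \<ge> 1" using element_dim_le[OF p(1)] p(2) by simp
  then have "opposite_number d = Qe * q ^ (d - 1) * opposite_number (d - 1)"
    using opposite_number_Suc[of "d - 1"] by simp
  then have "opposite_number d + opposite_number (d - 1)
      = (q ^ (d - 1) * Qe + 1) * opposite_number (d - 1)"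
    by (simp add: algebra_simps)
  moreover have "q ^ (d - 1) * Qe + 1 > 0" using q_ge2 Qe_pos by (simp add: add_pos_pos)
  ultimately show ?thesis
    using card_generators_point[OF p] opposite_eigenvalue_first by simp
qed

theorem cross_intersecting_hyperbolic:
  assumes "cross_intersecting_EKR d P Y Z" "d \<ge> 1" "Qe = q powr polar_type K" "Qe = 1"
  shows "sqrt (real (card Y) * real (card Z)) \<le> real (card G) / 2 \<and>
    (sqrt (real (card Y) * real (card Z)) = real (card G) / 2 \<longrightarrow>
      indicator Y \<in> eigenspace_sum K d P {0, d} \<and> indicator Z \<in> eigenspace_sum K d P {0, d})"
proof -
  have pos: "opposite_number d > 0" using q_ge2 Qe_pos by (simp add: opposite_number_def)
  have "opposite_number d = q ^ (d choose 2)"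
    unfolding opposite_number_def by (simp add: assms(4))
  then have last: "\<bar>opposite_eigenvalue d\<bar> = opposite_number d"
    unfolding abs_opposite_eigenvalue by (simp add: assms(4) numeral_2_eq_2)
  have le: "\<bar>opposite_eigenvalue r\<bar> \<le> opposite_number d" if "1 \<le> r" "r \<le> d" for r
    using hyperbolic_eigenvalue_less[OF assms(4) that(1)] last that(2) by (cases "r = d") auto
  have less: "\<bar>opposite_eigenvalue r\<bar> < opposite_number d" if "r \<le> d" "r \<notin> {0, d}" for r
    using hyperbolic_eigenvalue_less[OF assms(4)] that by simp
  have half: "real (card G) * opposite_number d / (opposite_number d + opposite_number d) = real (card G) / 2"
    using pos by (simp add: field_simps)
  have "{0, d} \<subseteq> {..d}" "0 \<in> {0, d}" by auto
  note bound = cross_intersecting_bound[OF assms(1-3) pos le this less, unfolded half]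
  show ?thesis using bound by blast
qed

theorem cross_intersecting_point:
  assumes "cross_intersecting_EKR d P Y Z" "Qe = q powr polar_type K" "Qe \<ge> q"
    and p: "p \<in> P" "vec.dim p = 1"
    and R: "R = (if Qe > q then {0, 1} else {0, 1, d})"
  shows "sqrt (real (card Y) * real (card Z)) \<le> real (card {g \<in> G. p \<subseteq> g}) \<and>
    (sqrt (real (card Y) * real (card Z)) = real (card {g \<in> G. p \<subseteq> g}) \<longrightarrow>
      indicator Y \<in> eigenspace_sum K d P R \<and> indicator Z \<in> eigenspace_sum K d P R)"
proof -
  have d: "d \<ge> 1" using element_dim_le[OF p(1)] p(2) by simp
  have less: "\<bar>opposite_eigenvalue r\<bar> < opposite_number (d - 1)" if "r \<le> d" "r \<notin> R" for r
    using opposite_eigenvalue_le(2)[OF assms(3), of r] that by (auto simp: R split: if_splits)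
  have "R \<subseteq> {..d}" "0 \<in> R" using d by (auto simp: R)
  note bound = cross_intersecting_bound[OF assms(1) d assms(2) opposite_eigenvalue_first
      opposite_eigenvalue_le(1)[OF assms(3)] this less, unfolded hoffman_value_point[OF p]]
  show ?thesis using bound by blast
qed

end

theorem theorem5p1:
  fixes K :: polar_family and d :: nat
    and P Y Z :: "('k::{field,finite} ^ 'n) set set"
  assumes "classical_polar_space K d P"
    and "cross_intersecting_EKR d P Y Z"
  shows "(K = Hyperbolic \<longrightarrow>
            sqrt (real (card Y) * real (card Z)) \<le> real (card (generators d P)) / 2 \<and>
            (sqrt (real (card Y) * real (card Z)) = real (card (generators d P)) / 2 \<longrightarrow>
               indicator Y \<in> eigenspace_sum K d P {0, d} \<and>
               indicator Z \<in> eigenspace_sum K d P {0, d}))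
       \<and> (K \<in> {Parabolic, Symplectic} \<longrightarrow>
            (\<forall>p\<in>points P.
              sqrt (real (card Y) * real (card Z)) \<le> real (card {g \<in> generators d P. p \<subseteq> g}) \<and>
              (sqrt (real (card Y) * real (card Z)) = real (card {g \<in> generators d P. p \<subseteq> g}) \<longrightarrow>
                 indicator Y \<in> eigenspace_sum K d P {0, 1, d} \<and>
                 indicator Z \<in> eigenspace_sum K d P {0, 1, d})))
       \<and> (K \<in> {Hermitian_Even, Elliptic} \<longrightarrow>
            (\<forall>p\<in>points P.
              sqrt (real (card Y) * real (card Z)) \<le> real (card {g \<in> generators d P. p \<subseteq> g}) \<and>
              (sqrt (real (card Y) * real (card Z)) = real (card {g \<in> generators d P. p \<subseteq> g}) \<longrightarrow>
                 indicator Y \<in> eigenspace_sum K d P {0, 1} \<and>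
                 indicator Z \<in> eigenspace_sum K d P {0, 1})))"
proof -
  let ?q = "real CARD('k)"
  have q: "?q > 1" using CARD_field_ge2[where 'k = 'k] by linarith
  obtain orth where "regular_polar_geometry P orth d ?q (?q powr polar_type K)"
    using classical_polar_space_regular[OF assms(1)] by blast
  then interpret regular_polar_geometry P orth d ?q "?q powr polar_type K" .
  have hyperbolic: "K = Hyperbolic \<Longrightarrow> d \<ge> 1 \<and> ?q powr polar_type K = 1"
    using assms(1) q zero_less_card_finite[where ?'a = 'n]
    by (auto simp: classical_polar_space_def Suc_le_eq intro!: Nat.gr0I)
  have one: "K \<in> {Parabolic, Symplectic} \<Longrightarrow> ?q powr polar_type K = ?q" using q by auto
  have large: "?q powr polar_type K > ?q" if "K \<in> {Hermitian_Even, Elliptic}"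
  proof -
    have "?q powr 1 < ?q powr polar_type K" using that q by (intro powr_less_mono) auto
    then show ?thesis using q by simp
  qed
  show ?thesis
  proof (intro conjI impI ballI)
    assume "K = Hyperbolic"
    note h = cross_intersecting_hyperbolic[OF assms(2) conjunct1[OF hyperbolic[OF this]] refl
        conjunct2[OF hyperbolic[OF this]]]
    show "sqrt (real (card Y) * real (card Z)) \<le> real (card (generators d P)) / 2"
      using h by blast
    assume "sqrt (real (card Y) * real (card Z)) = real (card (generators d P)) / 2"
    then show "indicator Y \<in> eigenspace_sum K d P {0, d}" "indicator Z \<in> eigenspace_sum K d P {0, d}"
      using h by blast+
  next
    fix p assume K: "K \<in> {Parabolic, Symplectic}" and "p \<in> points P"
    then have p: "p \<in> P" "vec.dim p = 1" by (auto simp: points_def)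
    have R: "{0, 1, d} = (if ?q powr polar_type K > ?q then {0, 1} else {0, 1, d})"
      unfolding one[OF K] by simp
    note h = cross_intersecting_point[OF assms(2) refl order_eq_refl[OF one[OF K, symmetric]] p R]
    show "sqrt (real (card Y) * real (card Z)) \<le> real (card {g \<in> generators d P. p \<subseteq> g})"
      using h by blast
    assume "sqrt (real (card Y) * real (card Z)) = real (card {g \<in> generators d P. p \<subseteq> g})"
    then show "indicator Y \<in> eigenspace_sum K d P {0, 1, d}" "indicator Z \<in> eigenspace_sum K d P {0, 1, d}"
      using h by blast+
  next
    fix p assume K: "K \<in> {Hermitian_Even, Elliptic}" and "p \<in> points P"
    then have p: "p \<in> P" "vec.dim p = 1" by (auto simp: points_def)
    have R: "{0, 1} = (if ?q powr polar_type K > ?q then {0, 1} else {0, 1, d})"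
      using large[OF K] by simp
    note h = cross_intersecting_point[OF assms(2) refl less_imp_le[OF large[OF K]] p R]
    show "sqrt (real (card Y) * real (card Z)) \<le> real (card {g \<in> generators d P. p \<subseteq> g})"
      using h by blast
    assume "sqrt (real (card Y) * real (card Z)) = real (card {g \<in> generators d P. p \<subseteq> g})"
    then show "indicator Y \<in> eigenspace_sum K d P {0, 1}" "indicator Z \<in> eigenspace_sum K d P {0, 1}"
      using h by blast+
  qed
qed

end
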